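(* Let $N\ge1$ be an integer, $a>0$, and let $A$ be the doubly infinite tridiagonal Jacobi matrix with diagonal entries $a_j=a\cos(2j\pi/N)$, $j\in\mathbb{Z}$, and all off-diagonal entries (directly above and below the diagonal) equal to $1/2$. Let $P_n$, $P_n^*$, $g_N$ be as in the context and let $\xi_1<\xi_2\le\xi_3<\xi_4\le\cdots\le\xi_{2N-1}<\xi_{2N}$ be the roots (counting multiplicity) of $g_N^2(x)=1$. Then the spectral measure $(d\mu_{ij})_{i,j\in\{0,1\}}$ of $A$ is absolutely continuous and given by $$\frac{d\mu_{00}(x)}{dx}=\frac{|P_N^*(x)|}{2\pi\sqrt{1-g_N^2(x)}},\qquad \frac{d\mu_{01}(x)}{dx}=\frac{(x-a)|P_N^*(x)|}{2\pi\sqrt{1-g_N^2(x)}},\qquad \frac{d\mu_{11}(x)}{dx}=\frac{|P_{N-1}(x)|}{\pi\sqrt{1-g_N^2(x)}}$$ for $x\in\bigcup_{k=1}^N(\xi_{2k-1},\xi_{2k})$ (these intervals carrying the measures).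
   Context: Let $q=e^{2\pi i/N}$, so $a(q^n+q^{-n})=2a\cos(2\pi n/N)$. The polynomials $P_n(x)$ are defined by $P_0(x)=1$, $P_1(x)=2x-2a$ and $$2xP_n(x)=P_{n+1}(x)+a(q^n+q^{-n})P_n(x)+P_{n-1}(x),\quad n\ge1.$$ The numerator polynomials $P_n^*(x)$ are defined by the same recurrence for $n\ge 1$ with $P_0^*(x)=0$ and $P_1^*(x)=2$. The polynomial $$g_N(x)=\frac{P_N(x)-P_{N-1}^*(x)/2}{2}$$ has degree $N$; the $2N$ roots of $g_N^2(x)=1$ are all real and can be ordered as in the claim. $A$ acts on $\ell^2(\mathbb{Z})$ with standard basis $(e_n)_{n\in\mathbb{Z}}$ by $Ae_n=\tfrac12e_{n-1}+a_ne_n+\tfrac12e_{n+1}$ and is self-adjoint. Its spectral measure is the symmetric $2\times2$ matrix of (finite real) measures $(\mu_{ij})_{i,j\in\{0,1\}}$, $\mu_{01}=\mu_{10}$, determined by $$\int_{\mathbb{R}}\frac{d\mu_{ij}(x)}{z-x}=\langle e_i,(zI-A)^{-1}e_j\rangle,\quad z\in\mathbb{C}\setminus\mathbb{R},\ i,j\in\{0,1\}.$$ *)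

theory Defs
  imports "HOL-Analysis.Analysis" "HOL-Computational_Algebra.Polynomial"
begin

subsection \<open>The Jacobi matrix as an operator on square-summable sequences\<close>

definition ell2 :: "(int \<Rightarrow> complex) set" where
  "ell2 = {f. (\<lambda>n. (cmod (f n))\<^sup>2) summable_on UNIV}"

definition ell2_inner :: "(int \<Rightarrow> complex) \<Rightarrow> (int \<Rightarrow> complex) \<Rightarrow> complex" where
  "ell2_inner f g = (\<Sum>\<^sub>\<infinity>n. cnj (f n) * g n)"

definition ebasis :: "int \<Rightarrow> int \<Rightarrow> complex" where
  "ebasis i = (\<lambda>n. if n = i then 1 else 0)"

definition matrix_op :: "(int \<Rightarrow> int \<Rightarrow> real) \<Rightarrow> (int \<Rightarrow> complex) \<Rightarrow> (int \<Rightarrow> complex)" where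
  "matrix_op M f = (\<lambda>m. \<Sum>\<^sub>\<infinity>n. complex_of_real (M m n) * f n)"

definition jacobi_diag :: "real \<Rightarrow> nat \<Rightarrow> int \<Rightarrow> real" where
  "jacobi_diag a N j = a * cos (2 * real_of_int j * pi / real N)"

definition jacobi_matrix :: "real \<Rightarrow> nat \<Rightarrow> int \<Rightarrow> int \<Rightarrow> real" where
  "jacobi_matrix a N m n =
     (if m = n then jacobi_diag a N n else if \<bar>m - n\<bar> = 1 then 1/2 else 0)"

definition jacobi_op :: "real \<Rightarrow> nat \<Rightarrow> (int \<Rightarrow> complex) \<Rightarrow> (int \<Rightarrow> complex)" where
  "jacobi_op a N = matrix_op (jacobi_matrix a N)"

lemma jacobi_op_apply:
  "jacobi_op a N f m =
     1/2 * f (m - 1) + complex_of_real (jacobi_diag a N m) * f m + 1/2 * f (m + 1)"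
proof -
  have "jacobi_op a N f m =
      (\<Sum>\<^sub>\<infinity>n\<in>{m - 1, m, m + 1}. complex_of_real (jacobi_matrix a N m n) * f n)"
    unfolding jacobi_op_def matrix_op_def
    by (rule infsum_cong_neutral) (auto simp: jacobi_matrix_def)
  also have "\<dots> = (\<Sum>n\<in>{m - 1, m, m + 1}. complex_of_real (jacobi_matrix a N m n) * f n)"
    by (rule infsum_finite) simp
  finally show ?thesis
    by (simp add: jacobi_matrix_def)
qed

lemma jacobi_op_ebasis:
  "jacobi_op a N (ebasis n) =
     (\<lambda>m. 1/2 * ebasis (n - 1) m + complex_of_real (jacobi_diag a N n) * ebasis n m
          + 1/2 * ebasis (n + 1) m)"
  by (rule ext) (auto simp: jacobi_op_apply ebasis_def)

text \<open>The resolvent \<open>(zI - T)\<inverse>\<close>, the inverse being that of \<open>zI - T\<close> as a map on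
  \<^const>\<open>ell2\<close>; it is meaningful whenever this map is a bijection of \<^const>\<open>ell2\<close>, in particular
  for self-adjoint \<open>T\<close> and non-real \<open>z\<close>.\<close>

definition resolvent ::
  "((int \<Rightarrow> complex) \<Rightarrow> (int \<Rightarrow> complex)) \<Rightarrow> complex \<Rightarrow> (int \<Rightarrow> complex) \<Rightarrow> (int \<Rightarrow> complex)" where
  "resolvent T z = the_inv_into ell2 (\<lambda>u n. z * u n - T u n)"


subsection \<open>Finite real (signed) Borel measures\<close>

text \<open>A finite real measure is a set function whose values off the Borel sets are irrelevant.\<close>

definition finite_real_measure :: "(real set \<Rightarrow> real) \<Rightarrow> bool" where
  "finite_real_measure \<nu> \<longleftrightarrow>
     (\<forall>F :: nat \<Rightarrow> real set. range F \<subseteq> sets borel \<longrightarrow> disjoint_family F \<longrightarrow>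
        (\<lambda>n. \<nu> (F n)) sums \<nu> (\<Union>n. F n))"

text \<open>\<open>Q\<close> and \<open>R\<close> are the positive and the negative part of \<open>\<nu>\<close>, concentrated on a Borel set \<open>H\<close>
  and on its complement.\<close>

definition jordan_decomposition ::
  "(real set \<Rightarrow> real) \<Rightarrow> real measure \<Rightarrow> real measure \<Rightarrow> bool" where
  "jordan_decomposition \<nu> Q R \<longleftrightarrow>
     finite_measure Q \<and> finite_measure R \<and> sets Q = sets borel \<and> sets R = sets borel \<and>
     (\<exists>H \<in> sets borel. measure Q (- H) = 0 \<and> measure R H = 0) \<and>
     (\<forall>E \<in> sets borel. \<nu> E = measure Q E - measure R E)"

definition has_real_measure_integral ::
  "(real set \<Rightarrow> real) \<Rightarrow> (real \<Rightarrow> complex) \<Rightarrow> complex \<Rightarrow> bool" where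
  "has_real_measure_integral \<nu> f I \<longleftrightarrow>
     (\<exists>Q R. jordan_decomposition \<nu> Q R \<and> integrable Q f \<and> integrable R f \<and>
            I = integral\<^sup>L Q f - integral\<^sup>L R f)"

text \<open>\<open>\<nu>\<close> is absolutely continuous with respect to Lebesgue measure and \<open>d\<nu>/dx = \<rho>\<close>.\<close>

definition absolutely_continuous_with_density ::
  "(real set \<Rightarrow> real) \<Rightarrow> (real \<Rightarrow> real) \<Rightarrow> bool" where
  "absolutely_continuous_with_density \<nu> \<rho> \<longleftrightarrow>
     integrable lborel \<rho> \<and> (\<forall>E \<in> sets borel. \<nu> E = (LINT x:E|lborel. \<rho> x))"

definition is_spectral_measure ::
  "((int \<Rightarrow> complex) \<Rightarrow> (int \<Rightarrow> complex)) \<Rightarrow> (int \<Rightarrow> int \<Rightarrow> real set \<Rightarrow> real) \<Rightarrow> bool" where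
  "is_spectral_measure T \<mu> \<longleftrightarrow>
     (\<forall>i \<in> {0, 1}. \<forall>j \<in> {0, 1}.
        finite_real_measure (\<mu> i j) \<and>
        (\<forall>E \<in> sets borel. \<mu> i j E = \<mu> j i E) \<and>
        (\<forall>z. z \<notin> \<real> \<longrightarrow>
           has_real_measure_integral (\<mu> i j) (\<lambda>x. 1 / (z - complex_of_real x))
             (ell2_inner (ebasis i) (resolvent T z (ebasis j)))))"


subsection \<open>The polynomials\<close>

text \<open>The recurrence is solved for its top term; with \<open>q = exp (2 \<pi> i / N)\<close> the coefficient
  \<open>a (q ^ n + q ^ -n)\<close> is \<open>2 * jacobi_diag a N n\<close>.\<close>

fun Ppoly :: "real \<Rightarrow> nat \<Rightarrow> nat \<Rightarrow> real poly" where
  "Ppoly a N 0 = 1"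
| "Ppoly a N (Suc 0) = [:- 2 * a, 2:]"
| "Ppoly a N (Suc (Suc n)) =
     [:- 2 * jacobi_diag a N (int (Suc n)), 2:] * Ppoly a N (Suc n) - Ppoly a N n"

fun Pstar :: "real \<Rightarrow> nat \<Rightarrow> nat \<Rightarrow> real poly" where
  "Pstar a N 0 = 0"
| "Pstar a N (Suc 0) = [:2:]"
| "Pstar a N (Suc (Suc n)) =
     [:- 2 * jacobi_diag a N (int (Suc n)), 2:] * Pstar a N (Suc n) - Pstar a N n"

definition gN_poly :: "real \<Rightarrow> nat \<Rightarrow> real poly" where
  "gN_poly a N = smult (1/2) (Ppoly a N N - smult (1/2) (Pstar a N (N - 1)))"

end

theory Submission
  imports Defs "HOL-Real_Asymp.Real_Asymp"
begin

text \<open>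
  The even and the odd solution \<open>c\<close>, \<open>s\<close> of \<open>u (n + 1) + u (n - 1) = 2 (z - a_n) u n\<close> (they exist
  because the diagonal is symmetric) have monodromy \<open>c (n + N) = g c n + D s n\<close>,
  \<open>s (n + N) = s_N c n + g s n\<close> with \<open>g\<^sup>2 - 1 = D s_N\<close> and \<open>2 s_N = P\<^sup>*_N\<close>. The Weyl solution \<open>c + m s\<close>
  has \<open>m\<^sup>2 = D / s_N\<close>, and the resolvent entries are \<open>G_00 = - 1 / m\<close>, \<open>G_01 = (z - a) G_00 - 1\<close>,
  \<open>G_11 = (z - a)\<^sup>2 G_00 + m\<close>. Hence \<open>G_00\<^sup>2 = s_N\<^sup>2 / (g\<^sup>2 - 1)\<close> and
  \<open>G_11\<^sup>2 = P_{N-1}\<^sup>2 / (g\<^sup>2 - 1)\<close>; together with \<open>Im G_jj \<le> 0\<close> in the upper half plane this determines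
  the boundary values of \<open>Im G\<close> on the real line without choosing branches of the square root. Stieltjes inversion
  turns them into densities. There are no atoms at closed gaps because \<open>D\<close> and \<open>s_N\<close> have only
  simple real roots, so that \<open>\<bar>D\<bar>\<close> and \<open>\<bar>s_N\<bar>\<close> to the power \<open>-1/2\<close> are locally integrable and dominate \<open>G\<close>.
\<close>

text \<open>Reflection \<open>n\<close> to \<open>- n\<close> carries the Weyl solution at plus
  infinity to the one at minus infinity, so one number m describes both half lines. The obstacle is
  a closed gap: there D and s_N vanish together, g_N^2 - 1 has a double root and 1 / sqrt |g_N^2 -
  1| is not locally integrable, so the formulas for the squares alone cannot exclude an atom. The
  entries are therefore estimated through m and 1 / m separately; the first has only s_N in the
  denominator, the second only D. Real-rootedness gives |p(x)| <= |p(x + i y)|, which makes these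
  estimates uniform in y; it comes from the hypothesis on the roots, which lists as many real roots
  of g_N^2 - 1 as its degree. The entry G_01 has no sign of its own: its boundary values are
  obtained from the linear relation with G_00, and its measure may be signed, which is why the
  inversion is carried out for Jordan decompositions.\<close>

section \<open>Real polynomials and the even and odd solutions\<close>

text \<open>Evaluation of a real polynomial in any real field, so that identities can be proved for real and
  complex arguments at once.\<close>

definition rpoly :: "real poly \<Rightarrow> 'a::real_field \<Rightarrow> 'a" where
  "rpoly p z = poly (map_poly of_real p) z"

lemma rpoly_0 [simp]: "rpoly 0 z = 0"
  by (simp add: rpoly_def)

lemma rpoly_pCons [simp]: "rpoly (pCons c p) z = of_real c + z * rpoly p z"
  by (simp add: rpoly_def map_poly_pCons)

lemma rpoly_1 [simp]: "rpoly 1 z = 1"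
  by (simp add: one_pCons)

lemma rpoly_add [simp]: "rpoly (p + q) z = rpoly p z + rpoly q z"
  by (induction p q rule: poly_induct2) (simp_all add: algebra_simps)

lemma rpoly_smult [simp]: "rpoly (smult c p) z = of_real c * rpoly p z"
  by (induction p) (simp_all add: algebra_simps)

lemma rpoly_minus [simp]: "rpoly (- p) z = - rpoly p z"
  using rpoly_smult[of "-1" p z] by simp

lemma rpoly_diff [simp]: "rpoly (p - q) z = rpoly p z - rpoly q z"
  using rpoly_add[of p "- q" z] by simp

lemma rpoly_mult [simp]: "rpoly (p * q) z = rpoly p z * rpoly q z"
  by (induction p) (simp_all add: algebra_simps)

lemma rpoly_power [simp]: "rpoly (p ^ n) z = rpoly p z ^ n"
  by (induction n) simp_all

lemma rpoly_prod_mset: "rpoly (\<Prod>r\<in>#M. f r) z = (\<Prod>r\<in>#M. rpoly (f r) z)"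
  by (induction M) simp_all

lemma rpoly_real: "rpoly p x = poly p x" for x :: real
  by (induction p) simp_all

lemma rpoly_of_real: "rpoly p (of_real x) = of_real (poly p x)"
  by (induction p) simp_all

lemma isCont_rpoly: "isCont (rpoly p) (z :: complex)"
  unfolding rpoly_def [abs_def] by simp

lemma continuous_on_rpoly: "continuous_on S (rpoly p :: complex \<Rightarrow> complex)"
  by (simp add: continuous_at_imp_continuous_on isCont_rpoly)

text \<open>Values at \<open>n \<ge> 0\<close> of the solutions that are odd and even in \<open>n\<close>.\<close>

definition odd_poly :: "real \<Rightarrow> nat \<Rightarrow> nat \<Rightarrow> real poly" where
  "odd_poly a N n = smult (1/2) (Pstar a N n)"

definition even_poly :: "real \<Rightarrow> nat \<Rightarrow> nat \<Rightarrow> real poly" where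
  "even_poly a N n = Ppoly a N n - [:- a, 1:] * odd_poly a N n"

lemma odd_poly_Suc_Suc:
  "odd_poly a N (Suc (Suc n)) =
     [:- 2 * jacobi_diag a N (int (Suc n)), 2:] * odd_poly a N (Suc n) - odd_poly a N n"
  unfolding odd_poly_def Pstar.simps by (simp only: smult_diff_right mult_smult_right)

lemma even_poly_Suc_Suc:
  "even_poly a N (Suc (Suc n)) =
     [:- 2 * jacobi_diag a N (int (Suc n)), 2:] * even_poly a N (Suc n) - even_poly a N n"
  unfolding even_poly_def odd_poly_Suc_Suc Ppoly.simps by algebra

lemma even_odd_poly_init:
  "even_poly a N 0 = 1" "even_poly a N (Suc 0) = [:- a, 1:]"
  "odd_poly a N 0 = 0" "odd_poly a N (Suc 0) = 1"
  by (simp_all add: even_poly_def odd_poly_def one_pCons)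

section \<open>Solutions of the three-term recurrence on the integers\<close>

definition is_solution :: "real \<Rightarrow> nat \<Rightarrow> 'a::real_field \<Rightarrow> (int \<Rightarrow> 'a) \<Rightarrow> bool" where
  "is_solution a N z u \<longleftrightarrow>
     (\<forall>n. u (n + 1) + u (n - 1) = 2 * (z - of_real (jacobi_diag a N n)) * u n)"

lemma solution_up:
  "is_solution a N z u \<Longrightarrow> u (n + 1) = 2 * (z - of_real (jacobi_diag a N n)) * u n - u (n - 1)"
  unfolding is_solution_def by (metis add_diff_cancel_right')

lemma solution_down:
  "is_solution a N z u \<Longrightarrow> u (n - 1) = 2 * (z - of_real (jacobi_diag a N n)) * u n - u (n + 1)"
  unfolding is_solution_def by (metis add_diff_cancel_left')

definition even_sol :: "real \<Rightarrow> nat \<Rightarrow> 'a::real_field \<Rightarrow> int \<Rightarrow> 'a" where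
  "even_sol a N z n = rpoly (even_poly a N (nat \<bar>n\<bar>)) z"

definition odd_sol :: "real \<Rightarrow> nat \<Rightarrow> 'a::real_field \<Rightarrow> int \<Rightarrow> 'a" where
  "odd_sol a N z n = (if n \<ge> 0 then 1 else - 1) * rpoly (odd_poly a N (nat \<bar>n\<bar>)) z"

lemma even_sol_minus [simp]: "even_sol a N z (- n) = even_sol a N z n"
  by (simp add: even_sol_def)

lemma odd_sol_0 [simp]: "odd_sol a N z 0 = 0"
  by (simp add: odd_sol_def even_odd_poly_init)

lemma odd_sol_minus [simp]: "odd_sol a N z (- n) = - odd_sol a N z n"
  by (cases "n = 0") (auto simp: odd_sol_def even_odd_poly_init)

lemma even_sol_0 [simp]: "even_sol a N z 0 = 1"
  by (simp add: even_sol_def even_odd_poly_init)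

lemma even_sol_1 [simp]: "even_sol a N z 1 = z - of_real a"
  by (simp add: even_sol_def even_odd_poly_init)

lemma odd_sol_1 [simp]: "odd_sol a N z 1 = 1"
  by (simp add: odd_sol_def even_odd_poly_init)

lemma jacobi_diag_minus [simp]: "jacobi_diag a N (- n) = jacobi_diag a N n"
  by (simp add: jacobi_diag_def)

lemma jacobi_diag_0 [simp]: "jacobi_diag a N 0 = a"
  by (simp add: jacobi_diag_def)

lemma jacobi_diag_period: "N \<ge> 1 \<Longrightarrow> jacobi_diag a N (n + int N) = jacobi_diag a N n"
proof -
  assume "N \<ge> 1"
  then have "2 * real_of_int (n + int N) * pi / real N = 2 * real_of_int n * pi / real N + 2 * pi"
    by (simp add: field_simps)
  then show ?thesis
    unfolding jacobi_diag_def by (simp only: cos_periodic)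
qed

text \<open>Since the diagonal is symmetric, reflection turns the equation at \<open>n < 0\<close>
  into the one at \<open>- n\<close>; the equation at 0 is not reached in this way and is a separate
  premise. The factor \<open>e\<close> is 1 for even and -1 for odd sequences.\<close>

lemma solution_by_parity:
  fixes u :: "int \<Rightarrow> 'a::real_field"
  assumes par: "\<And>n. u (- n) = e * u n"
    and u0: "u 1 + u (- 1) = 2 * (z - of_real a) * u 0"
    and pos: "\<And>n. n > 0 \<Longrightarrow> u (n + 1) + u (n - 1) = 2 * (z - of_real (jacobi_diag a N n)) * u n"
  shows "is_solution a N z u"
  unfolding is_solution_def
proof
  fix n :: int
  consider "n = 0" | "n > 0" | "n < 0" by linarith
  then show "u (n + 1) + u (n - 1) = 2 * (z - of_real (jacobi_diag a N n)) * u n"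
  proof cases
    case 3
    have "u (n + 1) + u (n - 1) = e * (u (- n - 1) + u (- n + 1))"
      using par[of "- n - 1"] par[of "- n + 1"] by (simp add: algebra_simps)
    also have "\<dots> = e * (2 * (z - of_real (jacobi_diag a N (- n))) * u (- n))"
      using pos[of "- n"] 3 by (simp add: add.commute)
    also have "\<dots> = 2 * (z - of_real (jacobi_diag a N n)) * u n"
      using par[of "- n"] by (simp add: algebra_simps)
    finally show ?thesis .
  qed (use u0 pos in auto)
qed

lemma even_sol_solution: "is_solution a N z (even_sol a N z)"
proof (rule solution_by_parity[where e = 1])
  fix n :: int assume "n > 0"
  then obtain k where n: "n = int (Suc k)"
    by (metis gr0_conv_Suc zero_less_imp_eq_int)
  have "nat \<bar>n + 1\<bar> = Suc (Suc k)" "nat \<bar>n - 1\<bar> = k" "nat \<bar>n\<bar> = Suc k" using n by auto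
  then show "even_sol a N z (n + 1) + even_sol a N z (n - 1) =
      2 * (z - of_real (jacobi_diag a N n)) * even_sol a N z n"
    by (simp add: even_sol_def even_poly_Suc_Suc n algebra_simps)
qed (simp_all add: algebra_simps)

lemma odd_sol_solution: "is_solution a N z (odd_sol a N z)"
proof (rule solution_by_parity[where e = "- 1"])
  fix n :: int assume "n > 0"
  then obtain k where n: "n = int (Suc k)"
    by (metis gr0_conv_Suc zero_less_imp_eq_int)
  have "nat \<bar>n + 1\<bar> = Suc (Suc k)" "nat \<bar>n - 1\<bar> = k" "nat \<bar>n\<bar> = Suc k"
    "n + 1 \<ge> 0" "n - 1 \<ge> 0" "n \<ge> 0" using n by auto
  then show "odd_sol a N z (n + 1) + odd_sol a N z (n - 1) =
      2 * (z - of_real (jacobi_diag a N n)) * odd_sol a N z n"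
    by (simp add: odd_sol_def odd_poly_Suc_Suc n algebra_simps)
qed (simp_all add: algebra_simps)

lemma solution_eqI:
  fixes u v :: "int \<Rightarrow> 'a::real_field"
  assumes u: "is_solution a N z u" and v: "is_solution a N z v"
    and "u 0 = v 0" "u 1 = v 1"
  shows "u n = v n"
proof -
  have "u n = v n \<and> u (n + 1) = v (n + 1)"
  proof (induction n rule: int_induct[where k = 0])
    case (step1 i)
    then show ?case using solution_up[OF u, of "i + 1"] solution_up[OF v, of "i + 1"] by simp
  next
    case (step2 i)
    then show ?case using solution_down[OF u, of i] solution_down[OF v, of i] by simp
  qed (use assms in auto)
  then show ?thesis by simp
qed

lemma solution_shift:
  "N \<ge> 1 \<Longrightarrow> is_solution a N z u \<Longrightarrow> is_solution a N z (\<lambda>n. u (n + int N))"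
  unfolding is_solution_def
proof
  fix n assume N: "N \<ge> 1"
    and u: "\<forall>n. u (n + 1) + u (n - 1) = 2 * (z - of_real (jacobi_diag a N n)) * u n"
  have "n + int N + 1 = n + 1 + int N" "n + int N - 1 = n - 1 + int N" by simp_all
  then show "u (n + 1 + int N) + u (n - 1 + int N) =
      2 * (z - of_real (jacobi_diag a N n)) * u (n + int N)"
    using u[rule_format, of "n + int N"] N by (simp only: jacobi_diag_period)
qed

lemma solution_lincomb:
  "is_solution a N z u \<Longrightarrow> is_solution a N z v \<Longrightarrow> is_solution a N z (\<lambda>n. c * u n + d * v n)"
  unfolding is_solution_def
proof
  fix n
  assume u: "\<forall>n. u (n + 1) + u (n - 1) = 2 * (z - of_real (jacobi_diag a N n)) * u n"
    and v: "\<forall>n. v (n + 1) + v (n - 1) = 2 * (z - of_real (jacobi_diag a N n)) * v n"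
  have "c * u (n + 1) + d * v (n + 1) + (c * u (n - 1) + d * v (n - 1)) =
      c * (u (n + 1) + u (n - 1)) + d * (v (n + 1) + v (n - 1))"
    by (simp add: algebra_simps)
  then show "c * u (n + 1) + d * v (n + 1) + (c * u (n - 1) + d * v (n - 1)) =
      2 * (z - of_real (jacobi_diag a N n)) * (c * u n + d * v n)"
    unfolding u[rule_format] v[rule_format] by (simp add: algebra_simps)
qed

lemma solution_basis:
  fixes u :: "int \<Rightarrow> 'a::real_field"
  assumes "is_solution a N z u"
  shows "u n = u 0 * even_sol a N z n + (u 1 - (z - of_real a) * u 0) * odd_sol a N z n"
  by (rule solution_eqI[OF assms solution_lincomb[OF even_sol_solution odd_sol_solution]])
    (simp_all add: algebra_simps)

section \<open>Monodromy over one period\<close>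

text \<open>The entry \<open>D\<close> of the monodromy matrix in the basis of the even and the odd solution.\<close>

definition disc_poly :: "real \<Rightarrow> nat \<Rightarrow> real poly" where
  "disc_poly a N = even_poly a N (Suc N) - [:- a, 1:] * even_poly a N N"

lemma rpoly_disc:
  "rpoly (disc_poly a N) z = even_sol a N z (1 + int N) - (z - of_real a) * even_sol a N z (int N)"
proof -
  have "nat \<bar>1 + int N\<bar> = Suc N" by simp
  then show ?thesis unfolding disc_poly_def even_sol_def by (simp add: algebra_simps)
qed

lemma even_sol_shift:
  assumes "N \<ge> 1"
  shows "even_sol a N z (n + int N) =
    even_sol a N z (int N) * even_sol a N z n + rpoly (disc_poly a N) z * odd_sol a N z n"
  using solution_basis[OF solution_shift[OF assms even_sol_solution], of a z n]
  by (simp add: rpoly_disc)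

text \<open>Shifting the even solution from \<open>- N\<close> to 0 gives 1 = g^2 - D s_N by parity,
  before the second column of the monodromy matrix is known.\<close>

lemma discriminant:
  assumes "N \<ge> 1"
  shows "(even_sol a N z (int N))\<^sup>2 - 1 = rpoly (disc_poly a N) z * odd_sol a N z (int N)"
  using even_sol_shift[OF assms, of a z "- int N"] by (simp add: power2_eq_square algebra_simps)

lemma wronskian:
  "even_sol a N z n * odd_sol a N z (n + 1) - even_sol a N z (n + 1) * odd_sol a N z n = 1"
proof -
  let ?W = "\<lambda>n. even_sol a N z n * odd_sol a N z (n + 1) - even_sol a N z (n + 1) * odd_sol a N z n"
  have step: "?W n = ?W (n - 1)" for n
    unfolding solution_up[OF even_sol_solution, of a N z n] solution_up[OF odd_sol_solution, of a N z n]
    by (simp add: algebra_simps)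
  show ?thesis
  proof (induction n rule: int_induct[where k = 0])
    case (step1 i)
    then show ?case using step[of "i + 1"] by simp
  next
    case (step2 i)
    then show ?case using step[of i] by simp
  qed simp
qed

text \<open>The second diagonal entry \<open>k\<close> of the monodromy matrix must equal g.
  Shifting from \<open>- N\<close> yields only s_N (g - k) = 0, which says nothing where s_N
  vanishes; the Wronskian yields g (g - k) = 0 as well. Since g^2 - D s_N = 1, the two together give
  g - k = 0.\<close>

lemma odd_sol_shift:
  assumes "N \<ge> 1"
  shows "odd_sol a N z (n + int N) =
    odd_sol a N z (int N) * even_sol a N z n + even_sol a N z (int N) * odd_sol a N z n"
proof -
  define k where "k = odd_sol a N z (1 + int N) - (z - of_real a) * odd_sol a N z (int N)"
  have sh: "odd_sol a N z (n + int N) = odd_sol a N z (int N) * even_sol a N z n + k * odd_sol a N z n" for n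
    using solution_basis[OF solution_shift[OF assms odd_sol_solution], of a z n]
    by (simp add: k_def algebra_simps)
  let ?g = "even_sol a N z (int N)" and ?s = "odd_sol a N z (int N)" and ?d = "rpoly (disc_poly a N) z"
  have 1: "?s * (?g - k) = 0"
    using sh[of "- int N"] by auto
  have 2: "?g\<^sup>2 - 1 = ?d * ?s"
    by (rule discriminant[OF assms])
  have "?g * k - ?d * ?s = 1"
    using wronskian[of a N z "int N"] sh[of 1] even_sol_shift[OF assms, of a z 1]
    by (simp add: algebra_simps)
  with 2 have 3: "?g * (?g - k) = 0" by (simp add: algebra_simps power2_eq_square)
  have "?g - k = ?g * (?g * (?g - k)) - ?d * (?s * (?g - k))"
    using arg_cong[OF 2, of "\<lambda>t. t * (?g - k)"] by (simp add: algebra_simps power2_eq_square)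
  then have "k = ?g" unfolding 1 3 by simp
  with sh show ?thesis by simp
qed

lemma rpoly_Pstar: "rpoly (Pstar a N n) z = 2 * odd_sol a N z (int n)"
  by (simp add: odd_sol_def odd_poly_def)

text \<open>\<open>Ppoly\<close> continues to the solution with values 0 at -1 and 1 at 0, hence
  this combination of the even and the odd one.\<close>

lemma rpoly_Ppoly:
  "rpoly (Ppoly a N n) z = even_sol a N z (int n) + (z - of_real a) * odd_sol a N z (int n)"
  by (simp add: odd_sol_def even_sol_def even_poly_def algebra_simps)

lemma sol_pred_period:
  assumes "N \<ge> 1"
  shows "odd_sol a N z (int (N - 1)) =
      (z - of_real a) * odd_sol a N z (int N) - even_sol a N z (int N)"
    and "even_sol a N z (int (N - 1)) =
      (z - of_real a) * even_sol a N z (int N) - rpoly (disc_poly a N) z"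
proof -
  have "int (N - 1) = - 1 + int N" using assms by auto
  then show "odd_sol a N z (int (N - 1)) =
      (z - of_real a) * odd_sol a N z (int N) - even_sol a N z (int N)"
    "even_sol a N z (int (N - 1)) =
      (z - of_real a) * even_sol a N z (int N) - rpoly (disc_poly a N) z"
    using odd_sol_shift[OF assms, of a z "- 1"] even_sol_shift[OF assms, of a z "- 1"]
    by (simp_all only: even_sol_minus odd_sol_minus even_sol_1 odd_sol_1) (simp_all add: mult.commute)
qed

text \<open>Since s_{N-1} = (z - a) s_N - c_N, the combination P_N - s_{N-1} is 2 c_N. So g_N is
  half the trace of the monodromy matrix.\<close>

lemma rpoly_gN:
  assumes "N \<ge> 1"
  shows "rpoly (gN_poly a N) z = even_sol a N z (int N)"
  unfolding gN_poly_def rpoly_smult rpoly_diff rpoly_Ppoly rpoly_Pstar sol_pred_period[OF assms]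
  by (simp add: field_simps)

text \<open>The terms (z - a) c_N cancel. Up to sign the right-hand side is the numerator that the
  formula for G_11 produces.\<close>

lemma rpoly_Ppoly_pred:
  assumes "N \<ge> 1"
  shows "rpoly (Ppoly a N (N - 1)) z =
    (z - of_real a)\<^sup>2 * odd_sol a N z (int N) - rpoly (disc_poly a N) z"
  unfolding rpoly_Ppoly sol_pred_period[OF assms] by (simp add: algebra_simps power2_eq_square)

text \<open>As an identity of polynomials this hands the real-rootedness of g_N^2 - 1 on to D and
  s_N.\<close>

lemma gN_poly_square:
  assumes "N \<ge> 1"
  shows "(gN_poly a N)\<^sup>2 - 1 = disc_poly a N * odd_poly a N N"
proof (rule poly_eq_poly_eq_iff[THEN iffD1], rule ext)
  fix x :: real
  have "rpoly ((gN_poly a N)\<^sup>2 - 1) x = rpoly (disc_poly a N * odd_poly a N N) x"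
    using discriminant[OF assms, of a x] rpoly_gN[OF assms, of a x] by (simp add: odd_sol_def)
  then show "poly ((gN_poly a N)\<^sup>2 - 1) x = poly (disc_poly a N * odd_poly a N N) x"
    unfolding rpoly_real .
qed

section \<open>Degree and leading coefficient of g_N\<close>

lemma degree_coeff_Ppoly: "degree (Ppoly a N n) \<le> n \<and> coeff (Ppoly a N n) n = 2 ^ n"
proof (induction a N n rule: Ppoly.induct)
  case (3 a N n)
  let ?l = "[:- 2 * jacobi_diag a N (int (Suc n)), 2:]"
  have "degree (?l * Ppoly a N (Suc n)) \<le> Suc (Suc n)"
    using degree_mult_le[of ?l "Ppoly a N (Suc n)"] 3 by (auto intro: order.trans)
  moreover have "degree (Ppoly a N n) < Suc (Suc n)" using 3 by simp
  ultimately show ?case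
    using 3 by (auto intro!: degree_diff_le simp: coeff_eq_0)
qed simp_all

lemma degree_Pstar: "degree (Pstar a N n) \<le> n"
proof (induction a N n rule: Pstar.induct)
  case (3 a N n)
  let ?l = "[:- 2 * jacobi_diag a N (int (Suc n)), 2:]"
  have "degree (?l * Pstar a N (Suc n)) \<le> Suc (Suc n)"
    using degree_mult_le[of ?l "Pstar a N (Suc n)"] 3 by (auto intro: order.trans)
  then show ?case
    using 3 by (auto intro!: degree_diff_le)
qed simp_all

lemma gN_poly_degree:
  assumes "N \<ge> 1"
  shows "degree (gN_poly a N) = N" "lead_coeff (gN_poly a N) > 0"
proof -
  have "degree (Pstar a N (N - 1)) < N"
    using degree_Pstar[of a N "N - 1"] assms by simp
  then have c: "coeff (gN_poly a N) N = 2 ^ N / 2"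
    using degree_coeff_Ppoly[of a N N] by (simp add: gN_poly_def coeff_eq_0)
  moreover have "degree (gN_poly a N) \<le> N"
    unfolding gN_poly_def using degree_coeff_Ppoly[of a N N] \<open>degree (Pstar a N (N - 1)) < N\<close>
    by (intro degree_smult_le[THEN order.trans] degree_diff_le) auto
  ultimately show *: "degree (gN_poly a N) = N"
    by (intro antisym le_degree) auto
  show "lead_coeff (gN_poly a N) > 0" unfolding * c by simp
qed

section \<open>Simplicity of the roots of D and s_N\<close>

text \<open>The Wronskian of a solution and its derivative in \<open>x\<close> is strictly increasing in \<open>n\<close>: this is what
  makes the roots of \<open>D\<close> and \<open>s_N\<close> simple.\<close>

lemma wronskian_derivative:
  fixes q :: "nat \<Rightarrow> real poly"
  assumes "\<And>n. q (Suc (Suc n)) = [:- 2 * \<alpha> (Suc n), 2:] * q (Suc n) - q n"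
  shows "poly (q n) x * poly (pderiv (q (Suc n))) x - poly (q (Suc n)) x * poly (pderiv (q n)) x =
    poly (q 0) x * poly (pderiv (q (Suc 0))) x - poly (q (Suc 0)) x * poly (pderiv (q 0)) x
    + 2 * (\<Sum>k=1..n. (poly (q k) x)\<^sup>2)"
proof (induction n)
  case (Suc n)
  have "pderiv (q (Suc (Suc n))) = [:- 2 * \<alpha> (Suc n), 2:] * pderiv (q (Suc n)) + q (Suc n) * [:2:] - pderiv (q n)"
    unfolding assms pderiv_diff pderiv_mult by (simp add: pderiv_pCons)
  from arg_cong[OF this, of "\<lambda>p. poly p x"] have 1: "poly (pderiv (q (Suc (Suc n)))) x =
      2 * (x - \<alpha> (Suc n)) * poly (pderiv (q (Suc n))) x + 2 * poly (q (Suc n)) x - poly (pderiv (q n)) x"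
    by (simp add: algebra_simps)
  have 2: "poly (q (Suc (Suc n))) x = 2 * (x - \<alpha> (Suc n)) * poly (q (Suc n)) x - poly (q n) x"
    unfolding assms by (simp add: algebra_simps)
  show ?case
    unfolding 1 2 using Suc by (simp add: algebra_simps power2_eq_square)
qed simp

text \<open>At a double root, c_{N+1} = (x - a) c_N holds together with its derivative, so the
  Wronskian with the derivative collapses to c_N^2. This is 1 because D vanishes, yet it should
  exceed its initial value 1 by at least 2 c_N^2.\<close>

lemma simple_root_disc:
  assumes "N \<ge> 1" "poly (disc_poly a N) x = 0"
  shows "poly (pderiv (disc_poly a N)) x \<noteq> 0"
proof
  assume D': "poly (pderiv (disc_poly a N)) x = 0"
  let ?c = "\<lambda>n. poly (even_poly a N n) x"
  have "poly ((gN_poly a N)\<^sup>2 - 1) x = 0"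
    unfolding gN_poly_square[OF assms(1)] using assms(2) by simp
  moreover have "poly (gN_poly a N) x = ?c N"
    using rpoly_gN[OF assms(1), of a x] by (simp add: rpoly_real even_sol_def)
  ultimately have g: "?c N * ?c N = 1" by (simp add: power2_eq_square)
  have 1: "?c (Suc N) = (x - a) * ?c N"
    using assms(2) by (simp add: disc_poly_def algebra_simps)
  have 2: "poly (pderiv (even_poly a N (Suc N))) x = ?c N + (x - a) * poly (pderiv (even_poly a N N)) x"
    using D' unfolding disc_poly_def pderiv_diff pderiv_mult by (simp add: pderiv_pCons algebra_simps)
  have "?c N * ?c N = 1 + 2 * (\<Sum>k=1..N. (?c k)\<^sup>2)"
    using wronskian_derivative[of "even_poly a N" "\<lambda>n. jacobi_diag a N (int n)" N x]
    unfolding 1 2 by (simp add: even_poly_Suc_Suc even_odd_poly_init pderiv_pCons algebra_simps)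
  then have "(\<Sum>k=1..N. (?c k)\<^sup>2) = 0" using g by simp
  moreover have "(?c N)\<^sup>2 \<le> (\<Sum>k=1..N. (?c k)\<^sup>2)"
    using assms(1) by (intro member_le_sum) auto
  ultimately show False using g by (simp add: power2_eq_square)
qed

text \<open>At a double root the Wronskian with the derivative vanishes at \<open>N\<close>, as it
  does at 0; but the sum of squares between them contains the term s_1 = 1.\<close>

lemma simple_root_odd:
  assumes "N \<ge> 1" "poly (odd_poly a N N) x = 0"
  shows "poly (pderiv (odd_poly a N N)) x \<noteq> 0"
proof
  assume D': "poly (pderiv (odd_poly a N N)) x = 0"
  let ?s = "\<lambda>n. poly (odd_poly a N n) x"
  have "(\<Sum>k=1..N. (?s k)\<^sup>2) = 0"
    using wronskian_derivative[of "odd_poly a N" "\<lambda>n. jacobi_diag a N (int n)" N x] D' assms(2)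
    by (simp add: odd_poly_Suc_Suc even_odd_poly_init)
  moreover have "(?s 1)\<^sup>2 \<le> (\<Sum>k=1..N. (?s k)\<^sup>2)"
    using assms(1) by (intro member_le_sum) auto
  ultimately show False by (simp add: even_odd_poly_init)
qed

section \<open>The resolvent of the Jacobi operator\<close>

lemma ell2_tendsto_0:
  assumes "u \<in> ell2"
  shows "(\<lambda>n. u (int n)) \<longlonglongrightarrow> 0" "(\<lambda>n. u (- int n)) \<longlonglongrightarrow> 0"
proof -
  have "(\<lambda>n. u (h n)) \<longlonglongrightarrow> 0" if "inj h" for h :: "nat \<Rightarrow> int"
  proof -
    have "(\<lambda>n. (cmod (u n))\<^sup>2) summable_on range h"
      using assms by (auto simp: ell2_def intro: summable_on_subset_banach)
    then have "summable (\<lambda>n. (cmod (u (h n)))\<^sup>2)"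
      using that by (simp add: summable_on_reindex o_def summable_on_imp_summable)
    then have "(\<lambda>n. sqrt ((cmod (u (h n)))\<^sup>2)) \<longlonglongrightarrow> sqrt 0"
      by (intro tendsto_real_sqrt summable_LIMSEQ_zero)
    then show ?thesis by (simp add: tendsto_norm_zero_iff)
  qed
  from this[of int] this[of "\<lambda>n. - int n"]
  show "(\<lambda>n. u (int n)) \<longlonglongrightarrow> 0" "(\<lambda>n. u (- int n)) \<longlonglongrightarrow> 0"
    by (simp_all add: inj_def)
qed

lemma ell2I:
  assumes "summable (\<lambda>n. (cmod (u (int n)))\<^sup>2)" "summable (\<lambda>n. (cmod (u (- int n)))\<^sup>2)"
  shows "u \<in> ell2"
proof -
  let ?f = "\<lambda>n. (cmod (u n))\<^sup>2"
  have "?f summable_on range int"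
    using assms(1) by (subst summable_on_reindex) (auto simp: o_def intro!: summable_nonneg_imp_summable_on)
  \<comment> \<open>The term at 0 belongs to both hypotheses and is dropped here, so that the two
    ranges are disjoint.\<close>
  moreover have "summable (\<lambda>n. (cmod (u (- int (Suc n))))\<^sup>2)"
    using assms(2) by (subst summable_Suc_iff)
  then have "?f summable_on range (\<lambda>n. - int (Suc n))"
    by (subst summable_on_reindex) (auto simp: o_def inj_on_def intro!: summable_nonneg_imp_summable_on)
  moreover have "range int \<inter> range (\<lambda>n. - int (Suc n)) = {}" by auto
  ultimately have "?f summable_on (range int \<union> range (\<lambda>n. - int (Suc n)))"
    by (rule summable_on_Un_disjoint)
  moreover have "range int \<union> range (\<lambda>n. - int (Suc n)) = UNIV"
    by (metis (no_types, lifting) UNIV_eq_I UnCI int_cases rangeI)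
  ultimately show ?thesis by (simp add: ell2_def)
qed

lemma ell2_inner_ebasis: "ell2_inner (ebasis i) u = u i"
proof -
  have "ell2_inner (ebasis i) u = (\<Sum>\<^sub>\<infinity>n\<in>{i}. cnj (ebasis i n) * u n)"
    unfolding ell2_inner_def by (rule infsum_cong_neutral) (auto simp: ebasis_def)
  then show ?thesis by (simp add: ebasis_def)
qed

section \<open>Current of a sequence; uniqueness and sign of the resolvent\<close>

text \<open>Up to a factor \<open>Im z\<close> the current of an eigenfunction is increasing; this replaces
  the self-adjointness of the operator in the arguments below.\<close>

definition current :: "(int \<Rightarrow> complex) \<Rightarrow> int \<Rightarrow> real" where
  "current u n = Im (cnj (u n) * u (n + 1))"

text \<open>The real diagonal contributes nothing to the imaginary part, and the two neighbours
  contribute the two currents. Keeping the residual \<open>z * u n - jacobi_op a N u n\<close> lets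
  the identity serve both eigenfunctions and columns of the resolvent.\<close>

lemma current_step:
  "current u n - current u (n - 1) =
     2 * (Im z * (cmod (u n))\<^sup>2 - Im (cnj (u n) * (z * u n - jacobi_op a N u n)))"
  unfolding current_def jacobi_op_apply cmod_power2
  by (simp add: field_simps power2_eq_square)

lemma current_tendsto_0:
  assumes "(\<lambda>n. u (int n)) \<longlonglongrightarrow> 0" "(\<lambda>n. u (- int n)) \<longlonglongrightarrow> 0"
  shows "(\<lambda>n. current u (int n)) \<longlonglongrightarrow> 0" "(\<lambda>n. current u (- int n)) \<longlonglongrightarrow> 0"
proof -
  have "(\<lambda>n. u (int (Suc n))) \<longlonglongrightarrow> 0"
    using assms(1) by (rule LIMSEQ_Suc)
  then have p: "(\<lambda>n. u (int n + 1)) \<longlonglongrightarrow> 0" by (simp add: add.commute)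
  have "(\<lambda>n. Im (cnj (u (int n)) * u (int n + 1))) \<longlonglongrightarrow> Im (cnj 0 * 0)"
    by (intro tendsto_intros assms p)
  then show "(\<lambda>n. current u (int n)) \<longlonglongrightarrow> 0" by (simp add: current_def)
  have "(\<lambda>n. Im (cnj (u (- int (Suc n))) * u (- int n))) \<longlonglongrightarrow> Im (cnj 0 * 0)"
    by (intro tendsto_intros assms LIMSEQ_Suc[OF assms(2)])
  then have "(\<lambda>n. current u (- int (Suc n))) \<longlonglongrightarrow> 0" by (simp add: current_def)
  then show "(\<lambda>n. current u (- int n)) \<longlonglongrightarrow> 0" by (subst (asm) filterlim_sequentially_Suc)
qed

text \<open>Monotonicity is asked for only up to \<open>k\<close>, because the current of a
  resolvent column is not controlled at its source.\<close>

lemma increasing_nonneg: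
  fixes f :: "int \<Rightarrow> real"
  assumes "\<And>n. n \<le> k \<Longrightarrow> f (n - 1) \<le> f n" "(\<lambda>n. f (- int n)) \<longlonglongrightarrow> 0"
  shows "0 \<le> f k"
proof (rule LIMSEQ_le_const2[OF assms(2)])
  have "f (k - int j) \<le> f k" for j
  proof (induction j)
    case (Suc j)
    have eq: "k - int (Suc j) = k - int j - 1" by simp
    have "f (k - int j - 1) \<le> f (k - int j)" by (rule assms(1)) simp
    with Suc show ?case unfolding eq by linarith
  qed simp
  note le = this
  have "f (- int n) \<le> f k" if "n \<ge> nat (- k)" for n
  proof -
    have "k + int n \<ge> 0" using that by linarith
    then show ?thesis using le[of "nat (k + int n)"] by simp
  qed
  then show "\<exists>n0. \<forall>n\<ge>n0. f (- int n) \<le> f k" by blast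
qed

lemma increasing_nonpos:
  fixes f :: "int \<Rightarrow> real"
  assumes "\<And>n. n > k \<Longrightarrow> f (n - 1) \<le> f n" "(\<lambda>n. f (int n)) \<longlonglongrightarrow> 0"
  shows "f k \<le> 0"
  using increasing_nonneg[of "- k" "\<lambda>n. - f (- n)"] assms(1)[of "- _ + 1"] tendsto_minus[OF assms(2)]
  by simp

text \<open>The factor \<open>Im z\<close> makes the current increase in both half planes, by
  multiples of (Im z)^2. It vanishes at both ends, so it is 0 throughout and so are its
  increments.\<close>

lemma vanishing_eigenfunction_eq_0:
  assumes z: "Im z \<noteq> 0"
    and lim: "(\<lambda>n. u (int n)) \<longlonglongrightarrow> 0" "(\<lambda>n. u (- int n)) \<longlonglongrightarrow> 0"
    and eq: "\<And>n. z * u n - jacobi_op a N u n = 0"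
  shows "u n = 0"
proof -
  let ?f = "\<lambda>n. Im z * current u n"
  have step: "?f n - ?f (n - 1) = 2 * (Im z)\<^sup>2 * (cmod (u n))\<^sup>2" for n
  proof -
    have "?f n - ?f (n - 1) = Im z * (current u n - current u (n - 1))" by (simp add: algebra_simps)
    also have "\<dots> = 2 * (Im z)\<^sup>2 * (cmod (u n))\<^sup>2"
      unfolding current_step[of u n z a N] eq by (simp add: power2_eq_square)
    finally show ?thesis .
  qed
  have mono: "?f (n - 1) \<le> ?f n" for n
    using step[of n] by (smt (verit) mult_nonneg_nonneg zero_le_power2)
  have l: "(\<lambda>n. ?f (int n)) \<longlonglongrightarrow> 0" "(\<lambda>n. ?f (- int n)) \<longlonglongrightarrow> 0"
    using current_tendsto_0[OF lim] by (auto intro: tendsto_mult_right_zero)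
  have "?f n = 0" for n
    using increasing_nonneg[of n ?f, OF mono l(2)] increasing_nonpos[of n ?f, OF mono l(1)] by linarith
  with step[of n] z show ?thesis by simp
qed

text \<open>Injectivity on \<open>ell2\<close> and one preimage determine the value of
  \<open>the_inv_into\<close>. Injectivity is \<open>vanishing_eigenfunction_eq_0\<close> for the
  difference of two preimages.\<close>

lemma resolvent_ebasis:
  assumes z: "Im z \<noteq> 0" and u: "u \<in> ell2"
    and eq: "\<And>n. z * u n - jacobi_op a N u n = ebasis j n"
  shows "resolvent (jacobi_op a N) z (ebasis j) = u"
  unfolding resolvent_def
proof (rule the_inv_into_f_eq)
  show "inj_on (\<lambda>u n. z * u n - jacobi_op a N u n) ell2"
  proof (rule inj_onI, rule ext)
    fix v w n
    assume vw: "v \<in> ell2" "w \<in> ell2"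
      and e: "(\<lambda>n. z * v n - jacobi_op a N v n) = (\<lambda>n. z * w n - jacobi_op a N w n)"
    let ?u = "\<lambda>n. v n - w n"
    have "z * ?u n - jacobi_op a N ?u n = 0" for n
      using fun_cong[OF e, of n] by (simp add: jacobi_op_apply algebra_simps)
    moreover have "(\<lambda>n. ?u (int n)) \<longlonglongrightarrow> 0" "(\<lambda>n. ?u (- int n)) \<longlonglongrightarrow> 0"
      using tendsto_diff[OF ell2_tendsto_0(1)[OF vw(1)] ell2_tendsto_0(1)[OF vw(2)]]
        tendsto_diff[OF ell2_tendsto_0(2)[OF vw(1)] ell2_tendsto_0(2)[OF vw(2)]] by simp_all
    ultimately have "?u n = 0" using vanishing_eigenfunction_eq_0[OF z, of ?u] by blast
    then show "v n = w n" by simp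
  qed
qed (use u eq in auto)

text \<open>Away from \<open>j\<close> the current increases, and it tends to 0 at both ends; hence
  it is nonnegative at \<open>j - 1\<close> and nonpositive at \<open>j\<close>. Its jump there is 2
  Im z |u j|^2 + 2 Im (u j), so Im (u j) is at most - Im z |u j|^2.\<close>

lemma resolvent_Im_nonpos:
  assumes z: "Im z > 0" and u: "u \<in> ell2"
    and eq: "\<And>n. z * u n - jacobi_op a N u n = ebasis j n"
  shows "Im (u j) \<le> 0"
proof -
  note l = current_tendsto_0[OF ell2_tendsto_0[OF u]]
  have step: "current u n - current u (n - 1) = 2 * Im z * (cmod (u n))\<^sup>2 - 2 * Im (cnj (u n) * ebasis j n)" for n
    unfolding current_step[of u n z a N] eq by (simp add: algebra_simps)
  have mono: "current u (n - 1) \<le> current u n" if "n \<noteq> j" for n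
    using step[of n] that z by (simp add: ebasis_def) (smt (verit) mult_nonneg_nonneg zero_le_power2)
  have "0 \<le> current u (j - 1)" by (rule increasing_nonneg[OF mono l(2)]) simp
  moreover have "current u j \<le> 0" by (rule increasing_nonpos[OF mono l(1)]) simp
  moreover have "0 \<le> Im z * (cmod (u j))\<^sup>2" using z by simp
  ultimately show ?thesis using step[of j] by (simp add: ebasis_def)
qed

section \<open>Floquet multipliers and the Weyl solution\<close>

lemma summable_geometric_blocks:
  fixes f :: "nat \<Rightarrow> real"
  assumes f: "\<And>n. f n \<ge> 0" and c: "c < 1" and shift: "\<And>n. f (n + N) = c * f n"
  shows "summable f"
proof (rule summableI_nonneg_bounded[OF f])
  fix n
  let ?T = "\<lambda>n. \<Sum>i<n. f i"
  \<comment> \<open>Comparing T(n) with T(n + N) = T(N) + c T(n) bounds all partial sums at once,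
    without splitting the indices into residue classes.\<close>
  have "?T n \<le> ?T (n + N)"
    using f by (intro sum_mono2) auto
  also have "?T (n + N) = ?T N + (\<Sum>i<n. f (i + N))"
    by (induction n) (simp_all add: add.commute)
  also have "\<dots> = ?T N + c * ?T n"
    by (simp add: shift sum_distrib_left)
  finally have "(1 - c) * ?T n \<le> ?T N" by (simp add: algebra_simps)
  then show "?T n \<le> ?T N / (1 - c)" using c by (simp add: field_simps)
qed

lemma solution_imp_eigen:
  assumes "is_solution a N z u"
  shows "z * u n - jacobi_op a N u n = 0"
  using solution_up[OF assms, of n] unfolding jacobi_op_apply by (simp add: field_simps)

text \<open>The matrix with rows (g, D) and (s_N, g) has the characteristic equation (w - g)^2 = D
  s_N, and c + m s is an eigenvector for \<open>w\<close>. Dividing by s_N turns that equation into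
  D = m^2 s_N, which matches the coefficients of s.\<close>

lemma floquet_solution:
  assumes N: "N \<ge> 1" and s: "odd_sol a N z (int N) \<noteq> 0"
    and w: "(w - even_sol a N z (int N))\<^sup>2 = (even_sol a N z (int N))\<^sup>2 - 1"
    and m: "m = (w - even_sol a N z (int N)) / odd_sol a N z (int N)"
  shows "even_sol a N z (n + int N) + m * odd_sol a N z (n + int N) =
    w * (even_sol a N z n + m * odd_sol a N z n)"
proof -
  let ?g = "even_sol a N z (int N)" and ?s = "odd_sol a N z (int N)" and ?D = "rpoly (disc_poly a N) z"
  have 1: "w = ?g + m * ?s" using m s by simp
  have "(m * ?s)\<^sup>2 = ?D * ?s"
    using w discriminant[OF N, of a z] unfolding 1 by simp
  then have 2: "?D = m * (m * ?s)"
    using s by (simp add: power2_eq_square)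
  show ?thesis
    unfolding even_sol_shift[OF N] odd_sol_shift[OF N] 2 1 by (simp add: algebra_simps)
qed

text \<open>With |w| = 1 the current would agree at -1 and N - 1, whereas Im z times the current
  strictly increases from -1 to 0, because \<open>u 0\<close> is nonzero, and does not decrease
  afterwards.\<close>

lemma floquet_multiplier_norm:
  assumes N: "N \<ge> 1" and z: "Im z \<noteq> 0" and u: "is_solution a N z u" and u0: "u 0 \<noteq> 0"
    and shift: "\<And>n. u (n + int N) = w * u n"
  shows "cmod w \<noteq> 1"
proof
  assume w: "cmod w = 1"
  let ?f = "\<lambda>n. Im z * current u n"
  have step: "?f n - ?f (n - 1) = 2 * (Im z)\<^sup>2 * (cmod (u n))\<^sup>2" for n
  proof -
    have "?f n - ?f (n - 1) = Im z * (current u n - current u (n - 1))" by (simp add: algebra_simps)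
    also have "\<dots> = 2 * (Im z)\<^sup>2 * (cmod (u n))\<^sup>2"
      unfolding current_step[of u n z a N] solution_imp_eigen[OF u] by (simp add: power2_eq_square)
    finally show ?thesis .
  qed
  have "?f 0 \<le> ?f (int k)" for k
  proof (induction k)
    case (Suc k)
    have eq: "int (Suc k) - 1 = int k" by simp
    have "0 \<le> 2 * (Im z)\<^sup>2 * (cmod (u (int (Suc k))))\<^sup>2" by simp
    with Suc show ?case using step[of "int (Suc k)"] unfolding eq by linarith
  qed simp
  from this[of "N - 1"] have "?f 0 \<le> ?f (- 1 + int N)" using N by simp
  also have "current u (- 1 + int N) = current u (- 1)"
  proof -
    have "u (- 1 + int N + 1) = w * u 0" "u (- 1 + int N) = w * u (- 1)"
      using shift[of 0] shift[of "- 1"] by simp_all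
    then have "current u (- 1 + int N) = Im (cnj w * w * (cnj (u (- 1)) * u 0))"
      unfolding current_def by (simp add: mult_ac)
    also have "cnj w * w = 1" using w by (metis complex_norm_square mult.commute of_real_1 one_power2)
    finally show ?thesis by (simp add: current_def)
  qed
  finally have "2 * (Im z)\<^sup>2 * (cmod (u 0))\<^sup>2 \<le> 0" using step[of 0] by simp
  moreover have "2 * (Im z)\<^sup>2 * (cmod (u 0))\<^sup>2 > 0" using z u0 by simp
  ultimately show False by simp
qed

text \<open>The two roots of w^2 - 2 g w + 1 have product 1 and neither has modulus 1, so one lies
  inside the unit disc; its solution decays geometrically over blocks of length
  \<open>N\<close>.\<close>

lemma weyl_solution:
  assumes N: "N \<ge> 1" and z: "Im z \<noteq> 0" and s: "odd_sol a N z (int N) \<noteq> 0"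
  obtains m where "m\<^sup>2 = rpoly (disc_poly a N) z / odd_sol a N z (int N)"
    "summable (\<lambda>n. (cmod (even_sol a N z (int n) + m * odd_sol a N z (int n)))\<^sup>2)"
proof -
  let ?g = "even_sol a N z (int N)" and ?s = "odd_sol a N z (int N)"
  \<comment> \<open>The sign \<open>e\<close> will be 1 or -1: it is not known in advance which root
    of the characteristic equation is the small one.\<close>
  let ?w = "\<lambda>e. ?g + e * csqrt (?g\<^sup>2 - 1)"
  have w: "(?w e - ?g)\<^sup>2 = ?g\<^sup>2 - 1" if "e\<^sup>2 = 1" for e
    using that by (simp add: power_mult_distrib)
  define \<phi> where "\<phi> = (\<lambda>e n. even_sol a N z n + (?w e - ?g) / ?s * odd_sol a N z n)"
  have sh: "\<phi> e (n + int N) = ?w e * \<phi> e n" if "e\<^sup>2 = 1" for e n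
    unfolding \<phi>_def by (rule floquet_solution[OF N s w[OF that] refl])
  have sol: "is_solution a N z (\<phi> e)" for e
    using solution_lincomb[OF even_sol_solution odd_sol_solution, of a N z 1 "(?w e - ?g) / ?s"]
    unfolding \<phi>_def mult_1_left .
  have ne1: "cmod (?w e) \<noteq> 1" if "e\<^sup>2 = 1" for e
    using floquet_multiplier_norm[of N z a "\<phi> e" "?w e", OF N z sol[of e] _ sh[OF that]] by (simp add: \<phi>_def)
  have "?w 1 * ?w (- 1) = 1"
    using w[of 1] by (simp add: algebra_simps power2_eq_square)
  then have prod: "cmod (?w 1) * cmod (?w (- 1)) = 1" by (metis norm_mult norm_one)
  have "\<exists>e. e\<^sup>2 = 1 \<and> cmod (?w e) < 1"
  proof (cases "cmod (?w 1) < 1")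
    case False
    then have "cmod (?w 1) > 1" using ne1[of 1] by simp
    moreover have "y < 1" if "1 < x" "x * y = 1" for x y :: real
    proof -
      have "y = 1 / x" using that by (simp add: eq_divide_eq mult.commute)
      with that show ?thesis by simp
    qed
    ultimately have "cmod (?w (- 1)) < 1" using prod by blast
    then show ?thesis by (intro exI[of _ "- 1"]) simp
  qed (auto intro: exI[of _ 1])
  then obtain e where e: "e\<^sup>2 = 1" "cmod (?w e) < 1" by blast
  let ?m = "(?w e - ?g) / ?s"
  have "?m\<^sup>2 = rpoly (disc_poly a N) z / ?s"
  proof -
    have "(?w e - ?g)\<^sup>2 = rpoly (disc_poly a N) z * ?s"
      using w[OF e(1)] discriminant[OF N, of a z] by (rule trans)
    then show ?thesis
      unfolding power_divide using s by (simp only:) (simp add: power2_eq_square)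
  qed
  moreover have "summable (\<lambda>n. (cmod (\<phi> e (int n)))\<^sup>2)"
  proof (rule summable_geometric_blocks)
    show "(cmod (?w e))\<^sup>2 < 1" using e(2) by (simp add: power_less_one_iff abs_square_less_1)
    show "(cmod (\<phi> e (int (n + N))))\<^sup>2 = (cmod (?w e))\<^sup>2 * (cmod (\<phi> e (int n)))\<^sup>2" for n
      using sh[OF e(1), of "int n"] by (simp add: norm_mult power_mult_distrib)
  qed simp
  ultimately show ?thesis using that[of ?m] unfolding \<phi>_def by blast
qed

section \<open>The Green function at the sites 0 and 1\<close>

definition green :: "real \<Rightarrow> nat \<Rightarrow> int \<Rightarrow> int \<Rightarrow> complex \<Rightarrow> complex" where
  "green a N i j z = ell2_inner (ebasis i) (resolvent (jacobi_op a N) z (ebasis j))"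

text \<open>The values \<phi>(1) = z - a + m and \<phi>(-1) = z - a - m make the entries explicit
  functions of \<open>m\<close>. The sign of \<open>m\<close> is left open; the inequalities for the
  imaginary parts stand in for it.\<close>

lemma green_entries:
  assumes N: "N \<ge> 1" and z: "Im z \<noteq> 0" and s: "odd_sol a N z (int N) \<noteq> 0"
    and D: "rpoly (disc_poly a N) z \<noteq> 0"
  obtains m where "m\<^sup>2 = rpoly (disc_poly a N) z / odd_sol a N z (int N)"
    "green a N 0 0 z = - 1 / m"
    "green a N 0 1 z = (z - of_real a) * green a N 0 0 z - 1"
    "green a N 1 1 z = (z - of_real a)\<^sup>2 * green a N 0 0 z + m"
    "Im z > 0 \<Longrightarrow> Im (green a N 0 0 z) \<le> 0"
    "Im z > 0 \<Longrightarrow> Im (green a N 1 1 z) \<le> 0"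
proof -
  obtain m where m: "m\<^sup>2 = rpoly (disc_poly a N) z / odd_sol a N z (int N)"
    and sm: "summable (\<lambda>n. (cmod (even_sol a N z (int n) + m * odd_sol a N z (int n)))\<^sup>2)"
    using weyl_solution[OF N z s] by blast
  have m0: "m \<noteq> 0" using m s D by auto
  define \<phi> where "\<phi> = (\<lambda>n. even_sol a N z n + m * odd_sol a N z n)"
  have sol: "is_solution a N z \<phi>"
    using solution_lincomb[OF even_sol_solution odd_sol_solution, of a N z 1] unfolding \<phi>_def by simp
  have sol': "is_solution a N z (\<lambda>n. \<phi> (- n))"
    using solution_lincomb[OF even_sol_solution odd_sol_solution, of a N z 1 "- m"] unfolding \<phi>_def by simp
  have v: "\<phi> 0 = 1" "\<phi> 1 = (z - of_real a) + m" "\<phi> (- 1) = (z - of_real a) - m"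
    using even_sol_minus[of a N z 1] odd_sol_minus[of a N z 1]
    by (simp_all add: \<phi>_def del: even_sol_minus odd_sol_minus)
  \<comment> \<open>The usual Green kernel: \<phi> decays to the right, its reflection to the left,
    and - m is half their Wronskian \<phi>(n - 1) \<phi>(- n) - \<phi>(n) \<phi>(1 - n), the half
    being the off-diagonal entry of the matrix.\<close>
  define u where "u = (\<lambda>j n. \<phi> (max n j) * \<phi> (- min n j) / (- m))"
  have ell: "u j \<in> ell2" if j: "j \<in> {0, 1}" for j
  proof (rule ell2I)
    have "summable (\<lambda>n. (cmod (\<phi> (- j) / (- m)))\<^sup>2 * (cmod (\<phi> (int n)))\<^sup>2)"
      using sm unfolding \<phi>_def by (rule summable_mult)
    \<comment> \<open>For \<open>j = 1\<close> the formula valid to the right of \<open>j\<close>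
      fails at \<open>n = 0\<close>, so the agreement is only eventual.\<close>
    moreover have "\<forall>\<^sub>F n in sequentially. (cmod (u j (int n)))\<^sup>2 = (cmod (\<phi> (- j) / (- m)))\<^sup>2 * (cmod (\<phi> (int n)))\<^sup>2"
      using eventually_ge_at_top[of 1]
      by eventually_elim (use j in \<open>auto simp: u_def norm_mult norm_divide power_mult_distrib power_divide\<close>)
    ultimately show "summable (\<lambda>n. (cmod (u j (int n)))\<^sup>2)" by (subst summable_cong)
    have "summable (\<lambda>n. (cmod (\<phi> j / (- m)))\<^sup>2 * (cmod (\<phi> (int n)))\<^sup>2)"
      using sm unfolding \<phi>_def by (rule summable_mult)
    moreover have "(cmod (u j (- int n)))\<^sup>2 = (cmod (\<phi> j / (- m)))\<^sup>2 * (cmod (\<phi> (int n)))\<^sup>2" for n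
      using j by (auto simp: u_def norm_mult norm_divide power_mult_distrib power_divide)
    ultimately show "summable (\<lambda>n. (cmod (u j (- int n)))\<^sup>2)" by simp
  qed
  have eq: "z * u j n - jacobi_op a N (u j) n = ebasis j n" if j: "j \<in> {0, 1}" for j n
  proof -
    consider "n > j" | "n < j" | "n = j" by linarith
    then show ?thesis
    proof cases
      case 1
      have "z * u j n - jacobi_op a N (u j) n = (z * \<phi> n - jacobi_op a N \<phi> n) * (\<phi> (- j) / (- m))"
        using 1 by (simp add: jacobi_op_apply u_def field_simps m0)
      then show ?thesis using 1 solution_imp_eigen[OF sol, of n] by (simp add: ebasis_def)
    next
      case 2
      have "z * u j n - jacobi_op a N (u j) n = (z * \<phi> (- n) - jacobi_op a N (\<lambda>n. \<phi> (- n)) n) * (\<phi> j / (- m))"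
        using 2 by (simp add: jacobi_op_apply u_def field_simps m0)
      then show ?thesis using 2 solution_imp_eigen[OF sol', of n] by (simp add: ebasis_def)
    next
      case 3
      \<comment> \<open>Only the neighbour j - 1 lies on the other branch of the kernel. Replacing
        its value \<phi>(j) \<phi>(1 - j) by \<phi>(j - 1) \<phi>(- j) completes the eigenvalue
        equation, at the cost of the Wronskian term.\<close>
      have "z * u j j - jacobi_op a N (u j) j =
          ((z * \<phi> j - jacobi_op a N \<phi> j) * \<phi> (- j) + (\<phi> (j - 1) * \<phi> (- j) - \<phi> j * \<phi> (1 - j)) / 2) / (- m)"
        using m0 by (simp add: jacobi_op_apply u_def field_simps)
      also have "\<dots> = (\<phi> (j - 1) * \<phi> (- j) - \<phi> j * \<phi> (1 - j)) / 2 / (- m)"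
        by (simp add: solution_imp_eigen[OF sol])
      also have "\<dots> = 1" using j m0 by (auto simp: v)
      finally show ?thesis using 3 by (simp add: ebasis_def)
    qed
  qed
  have green: "green a N i j z = u j i" if "j \<in> {0, 1}" for i j
    unfolding green_def ell2_inner_ebasis resolvent_ebasis[OF z ell[OF that] eq[OF that]] ..
  have nonpos: "Im (green a N j j z) \<le> 0" if "Im z > 0" "j \<in> {0, 1}" for j
    unfolding green[OF that(2)] by (rule resolvent_Im_nonpos[OF that(1) ell[OF that(2)] eq[OF that(2)]])
  have "green a N 0 0 z = - 1 / m" by (simp add: green u_def v)
  moreover have "green a N 0 1 z = (z - of_real a) * green a N 0 0 z - 1"
    using m0 by (simp add: green u_def v field_simps)
  moreover have "green a N 1 1 z = (z - of_real a)\<^sup>2 * green a N 0 0 z + m"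
    using m0 by (simp add: green u_def v field_simps power2_eq_square)
  ultimately show ?thesis using that[OF m] nonpos[of 0] nonpos[of 1] by simp
qed

section \<open>Stieltjes inversion\<close>

text \<open>The positive part is minimal: on \<open>H\<close> it agrees with \<nu>, which is at most
  \<open>Q'\<close>, and off \<open>H\<close> it has no mass.\<close>

lemma jordan_decomposition_le:
  assumes "jordan_decomposition \<nu> Q R" "jordan_decomposition \<nu> Q' R'" "E \<in> sets borel"
  shows "measure Q E \<le> measure Q' E"
proof -
  obtain H where H: "H \<in> sets borel" "measure Q (- H) = 0" "measure R H = 0"
    using assms(1) unfolding jordan_decomposition_def by blast
  interpret Q: finite_measure Q using assms(1) unfolding jordan_decomposition_def by blast
  interpret R: finite_measure R using assms(1) unfolding jordan_decomposition_def by blast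
  interpret Q': finite_measure Q' using assms(2) unfolding jordan_decomposition_def by blast
  have s [simp]: "sets Q = sets borel" "sets R = sets borel" "sets Q' = sets borel"
    using assms unfolding jordan_decomposition_def by blast+
  have nu: "\<nu> (E \<inter> H) = measure Q (E \<inter> H) - measure R (E \<inter> H)"
    "\<nu> (E \<inter> H) = measure Q' (E \<inter> H) - measure R' (E \<inter> H)"
    using assms H unfolding jordan_decomposition_def by blast+
  have R0: "measure R (E \<inter> H) = 0"
    using R.finite_measure_mono[of "E \<inter> H" H] H assms(3) by (simp add: measure_le_0_iff)
  have "measure Q (E - H) \<le> measure Q (- H)"
    using H by (intro Q.finite_measure_mono) auto
  with H have Q0: "measure Q (E - H) = 0" by (simp add: measure_le_0_iff)
  have "measure Q E = measure Q (E \<inter> H) + measure Q (E - H)"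
    using H assms(3) by (subst Q.finite_measure_Union[symmetric]) (auto simp: Int_Diff_Un)
  also have "\<dots> \<le> measure Q' (E \<inter> H)"
    using nu R0 Q0 measure_nonneg[of R' "E \<inter> H"] by linarith
  also have "\<dots> \<le> measure Q' E"
    using H assms(3) by (intro Q'.finite_measure_mono) auto
  finally show ?thesis .
qed

text \<open>\<open>has_real_measure_integral\<close> picks its measures anew for every integrand.
  Uniqueness lets a single pair serve for all \<open>z\<close> at once.\<close>

lemma jordan_decomposition_unique:
  assumes J: "jordan_decomposition \<nu> Q R" and J': "jordan_decomposition \<nu> Q' R'"
  shows "Q = Q'" "R = R'"
proof -
  interpret Q: finite_measure Q using J unfolding jordan_decomposition_def by blast
  interpret R: finite_measure R using J unfolding jordan_decomposition_def by blast
  interpret Q': finite_measure Q' using J' unfolding jordan_decomposition_def by blast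
  interpret R': finite_measure R' using J' unfolding jordan_decomposition_def by blast
  have s: "sets Q = sets borel" "sets R = sets borel" "sets Q' = sets borel" "sets R' = sets borel"
    using J J' unfolding jordan_decomposition_def by blast+
  have eq: "measure Q E = measure Q' E" if "E \<in> sets borel" for E
    using jordan_decomposition_le[OF J J' that] jordan_decomposition_le[OF J' J that] by simp
  then show "Q = Q'"
    using s by (intro measure_eqI) (auto simp: Q.emeasure_eq_measure Q'.emeasure_eq_measure)
  have "measure R E = measure R' E" if "E \<in> sets borel" for E
  proof -
    have "\<nu> E = measure Q E - measure R E" "\<nu> E = measure Q' E - measure R' E"
      using J J' that unfolding jordan_decomposition_def by blast+
    then show ?thesis using eq[OF that] by simp
  qed
  then show "R = R'"
    using s by (intro measure_eqI) (auto simp: R.emeasure_eq_measure R'.emeasure_eq_measure)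
qed

section \<open>Poisson integrals of a finite measure\<close>

definition poisson :: "real \<Rightarrow> real \<Rightarrow> real \<Rightarrow> real" where
  "poisson e x t = e / (pi * ((x - t)\<^sup>2 + e\<^sup>2))"

lemma poisson_nonneg: "e > 0 \<Longrightarrow> poisson e x t \<ge> 0"
  by (simp add: poisson_def)

lemma poisson_le: "e > 0 \<Longrightarrow> poisson e x t \<le> 1 / (pi * e)"
proof -
  assume e: "e > 0"
  have "pi * e * e \<le> pi * ((x - t)\<^sup>2 + e\<^sup>2)"
    by (simp add: power2_eq_square)
  then show ?thesis
    using e by (simp add: poisson_def divide_simps add_nonneg_pos)
qed

lemma poisson_eq_Im:
  assumes "e > 0"
  shows "poisson e x t = - Im (1 / (Complex x e - complex_of_real t)) / pi"
  using assms by (simp add: poisson_def Im_divide power2_eq_square cmod_def field_simps)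

lemma measurable_poisson [measurable]: "(\<lambda>(x, t). poisson e x t) \<in> borel_measurable (borel \<Otimes>\<^sub>M borel)"
  unfolding poisson_def by measurable

lemma poisson_integral_Icc:
  assumes "e > 0" "c \<le> d"
  shows "(LINT x|lborel. indicator {c..d} x * poisson e x t) =
    (arctan ((d - t) / e) - arctan ((c - t) / e)) / pi"
proof -
  have "((\<lambda>x. arctan ((x - t) / e) / pi) has_real_derivative poisson e x t) (at x)" for x
  proof -
    have "1 + ((x - t) / e)\<^sup>2 = ((x - t)\<^sup>2 + e\<^sup>2) / e\<^sup>2"
      using assms by (simp add: field_simps)
    then have "inverse (1 + ((x - t) / e)\<^sup>2) * (1 / e) / pi = poisson e x t"
      using assms by (simp add: poisson_def power2_eq_square)
    then show ?thesis
      using assms by (auto intro!: derivative_eq_intros)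
  qed
  moreover have "isCont (\<lambda>x. poisson e x t) x" for x
  proof -
    have "(x - t)\<^sup>2 + e\<^sup>2 > 0" using assms by (simp add: add_nonneg_pos)
    then show ?thesis unfolding poisson_def by (intro continuous_intros) auto
  qed
  ultimately have "(LBINT x. poisson e x t * indicator {c..d} x) =
      arctan ((d - t) / e) / pi - arctan ((c - t) / e) / pi"
    by (intro integral_FTC_Icc_real[OF assms(2)]) auto
  then show ?thesis by (simp add: mult.commute diff_divide_distrib)
qed

text \<open>The limit of the Poisson integrals of the indicator of an interval sees its end points with
  weight one half.\<close>

definition half_indicator :: "real \<Rightarrow> real \<Rightarrow> real \<Rightarrow> real" where
  "half_indicator c d t = (indicator {c..d} t + indicator {c<..<d} t) / 2"

lemma arctan_scale_tendsto:
  "(\<lambda>n. arctan (s / inverse (real (Suc n)))) \<longlonglongrightarrow> sgn s * (pi / 2)"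
proof -
  have n: "filterlim (\<lambda>n. real (Suc n)) at_top sequentially"
    by (rule filterlim_compose[OF filterlim_real_sequentially filterlim_Suc])
  have eq: "s / inverse (real (Suc n)) = s * real (Suc n)" for n
    by (simp add: divide_inverse)
  consider "s = 0" | "s > 0" | "s < 0" by linarith
  then show ?thesis
  proof cases
    case 2
    have "filterlim (\<lambda>n. s * real (Suc n)) at_top sequentially"
      by (rule filterlim_tendsto_pos_mult_at_top[OF tendsto_const 2 n])
    from filterlim_compose[OF tendsto_arctan_at_top this] show ?thesis
      unfolding eq using 2 by (simp only: sgn_pos mult_1_left)
  next
    case 3
    have "filterlim (\<lambda>n. s * real (Suc n)) at_bot sequentially"
      by (rule filterlim_tendsto_neg_mult_at_bot[OF tendsto_const 3 n])
    from filterlim_compose[OF tendsto_arctan_at_bot this] show ?thesis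
      unfolding eq using 3 by (simp only: sgn_neg mult_minus1)
  qed simp
qed

lemma poisson_integral_tendsto:
  assumes "c < d"
  shows "(\<lambda>n. (arctan ((d - t) / inverse (real (Suc n))) - arctan ((c - t) / inverse (real (Suc n)))) / pi)
    \<longlonglongrightarrow> half_indicator c d t"
proof -
  have "(\<lambda>n. (arctan ((d - t) / inverse (real (Suc n))) - arctan ((c - t) / inverse (real (Suc n)))) / pi)
    \<longlonglongrightarrow> (sgn (d - t) * (pi / 2) - sgn (c - t) * (pi / 2)) / pi"
    by (intro tendsto_intros arctan_scale_tendsto) simp
  also have "(sgn (d - t) * (pi / 2) - sgn (c - t) * (pi / 2)) / pi = half_indicator c d t"
    using assms by (auto simp: half_indicator_def sgn_if indicator_def field_simps)
  finally show ?thesis .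
qed

text \<open>Integrating over [c, d] first leaves a difference of arctangents, which is bounded by 1
  and converges at every point, so dominated convergence applies to any finite \<open>Q\<close>.
  Measurability and integrability are recorded for subtracting two such statements later.\<close>

lemma stieltjes_inversion_positive:
  fixes Q :: "real measure"
  assumes "finite_measure Q" and [measurable_cong, simp]: "sets Q = sets borel" and "c < d"
  shows "\<And>n. (\<lambda>x. LINT t|Q. poisson (inverse (real (Suc n))) x t) \<in> borel_measurable borel"
    and "\<And>n. integrable lborel (\<lambda>x. indicator {c..d} x * (LINT t|Q. poisson (inverse (real (Suc n))) x t))"
    and "(\<lambda>n. LINT x|lborel. indicator {c..d} x * (LINT t|Q. poisson (inverse (real (Suc n))) x t))
      \<longlonglongrightarrow> (LINT t|Q. half_indicator c d t)"
proof -
  interpret Q: finite_measure Q by fact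
  interpret QL: pair_sigma_finite lborel Q ..
  show meas: "(\<lambda>x. LINT t|Q. poisson (inverse (real (Suc n))) x t) \<in> borel_measurable borel" for n
    by measurable
  \<comment> \<open>This bound grows with \<open>n\<close>; it serves for integrability at each
    fixed height, as the exchange of integrals requires.\<close>
  have bnd: "\<bar>LINT t|Q. poisson (inverse (real (Suc n))) x t\<bar> \<le> real (Suc n) / pi * measure Q (space Q)" for n x
  proof -
    have "norm (LINT t|Q. poisson (inverse (real (Suc n))) x t) \<le> (LINT t|Q. real (Suc n) / pi)"
    proof (rule Bochner_Integration.integral_norm_bound_integral)
      show "integrable Q (\<lambda>t. poisson (inverse (real (Suc n))) x t)"
        using poisson_le[of "inverse (real (Suc n))" x] poisson_nonneg[of "inverse (real (Suc n))" x]
        by (intro Q.integrable_const_bound[where B = "real (Suc n) / pi"]) (auto simp: field_simps)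
      show "norm (poisson (inverse (real (Suc n))) x t) \<le> real (Suc n) / pi" for t
        using poisson_le[of "inverse (real (Suc n))" x t] poisson_nonneg[of "inverse (real (Suc n))" x t]
        by (auto simp: field_simps)
    qed simp
    then show ?thesis by (simp add: mult.commute)
  qed
  have cd: "integrable lborel (indicator {c..d} :: real \<Rightarrow> real)"
    by (intro integrable_real_indicator) (auto simp: emeasure_lborel_Icc_eq)
  show int: "integrable lborel (\<lambda>x. indicator {c..d} x * (LINT t|Q. poisson (inverse (real (Suc n))) x t))" for n
  proof (rule Bochner_Integration.integrable_bound)
    show "integrable lborel (\<lambda>x. indicator {c..d} x * (real (Suc n) / pi * measure Q (space Q)))"
      using cd by simp
    show "(\<lambda>x. indicator {c..d} x * (LINT t|Q. poisson (inverse (real (Suc n))) x t)) \<in> borel_measurable lborel"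
      using meas[of n] by measurable
    show "AE x in lborel. norm (indicator {c..d} x * (LINT t|Q. poisson (inverse (real (Suc n))) x t))
        \<le> norm (indicator {c..d} x * (real (Suc n) / pi * measure Q (space Q)))"
      using bnd[of n] by (auto simp: abs_mult indicator_def)
  qed
  let ?k = "\<lambda>n t. (arctan ((d - t) / inverse (real (Suc n))) - arctan ((c - t) / inverse (real (Suc n)))) / pi"
  have "(LINT x|lborel. indicator {c..d} x * (LINT t|Q. poisson (inverse (real (Suc n))) x t)) =
      (LINT t|Q. ?k n t)" for n
  proof -
    let ?e = "inverse (real (Suc n))"
    have "(LINT x|lborel. indicator {c..d} x * (LINT t|Q. poisson ?e x t)) =
        (LINT x|lborel. (LINT t|Q. indicator {c..d} x * poisson ?e x t))"
      by simp
    also have "\<dots> = (LINT t|Q. (LINT x|lborel. indicator {c..d} x * poisson ?e x t))"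
    proof (rule QL.Fubini_integral[symmetric])
      show "integrable (lborel \<Otimes>\<^sub>M Q) (\<lambda>(x, t). indicator {c..d} x * poisson ?e x t)"
      proof (rule QL.Fubini_integrable)
        show "(\<lambda>(x, t). indicator {c..d} x * poisson ?e x t) \<in> borel_measurable (lborel \<Otimes>\<^sub>M Q)"
          by measurable
        show "integrable lborel (\<lambda>x. LINT t|Q. norm (case (x, t) of (x, t) \<Rightarrow> indicator {c..d} x * poisson ?e x t))"
          using int[of n] poisson_nonneg[of ?e] by (simp add: abs_mult)
        show "AE x in lborel. integrable Q (\<lambda>t. case (x, t) of (x, t) \<Rightarrow> indicator {c..d} x * poisson ?e x t)"
          using poisson_le[of ?e] poisson_nonneg[of ?e]
          by (auto intro!: Q.integrable_const_bound[where B = "real (Suc n) / pi"] simp: field_simps)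
      qed
    qed
    also have "\<dots> = (LINT t|Q. ?k n t)"
      using \<open>c < d\<close> by (simp add: poisson_integral_Icc)
    finally show ?thesis .
  qed
  moreover have "(\<lambda>n. LINT t|Q. ?k n t) \<longlonglongrightarrow> (LINT t|Q. half_indicator c d t)"
  proof (rule integral_dominated_convergence[where w = "\<lambda>_. 1"])
    show "half_indicator c d \<in> borel_measurable Q" unfolding half_indicator_def by measurable
    show "?k n \<in> borel_measurable Q" for n by measurable
    show "AE t in Q. (\<lambda>n. ?k n t) \<longlonglongrightarrow> half_indicator c d t"
      using poisson_integral_tendsto[OF \<open>c < d\<close>] by simp
    show "AE t in Q. norm (?k n t) \<le> 1" for n
    proof (rule AE_I2)
      fix t
      have "\<bar>arctan ((d - t) / inverse (real (Suc n))) - arctan ((c - t) / inverse (real (Suc n)))\<bar> \<le> pi"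
        using arctan_bounded[of "(d - t) / inverse (real (Suc n))"] arctan_bounded[of "(c - t) / inverse (real (Suc n))"]
        by linarith
      then show "norm (?k n t) \<le> 1" by simp
    qed
  qed simp
  ultimately show "(\<lambda>n. LINT x|lborel. indicator {c..d} x * (LINT t|Q. poisson (inverse (real (Suc n))) x t))
      \<longlonglongrightarrow> (LINT t|Q. half_indicator c d t)"
    by simp
qed

text \<open>Approaching \<open>b\<close> from the right moves the half weight of the end point away
  from \<open>b\<close>: each t <= b eventually lies in the interior and each t > b outside.\<close>

lemma half_indicator_cdf:
  fixes Q :: "real measure"
  assumes "finite_measure Q" and [measurable_cong, simp]: "sets Q = sets borel"
  shows "(\<lambda>n. LINT t|Q. half_indicator (- real n) (b + inverse (real (Suc n))) t) \<longlonglongrightarrow> measure Q {..b}"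
proof -
  interpret Q: finite_measure Q by fact
  have [simp]: "space Q = UNIV" using sets_eq_imp_space_eq[OF assms(2)] by simp
  have "(\<lambda>n. LINT t|Q. half_indicator (- real n) (b + inverse (real (Suc n))) t) \<longlonglongrightarrow> (LINT t|Q. indicator {..b} t)"
  proof (rule integral_dominated_convergence[where w = "\<lambda>_. 1"])
    show "half_indicator c d \<in> borel_measurable Q" for c d unfolding half_indicator_def by measurable
    show "AE t in Q. (\<lambda>n. half_indicator (- real n) (b + inverse (real (Suc n))) t) \<longlonglongrightarrow> indicator {..b} t"
    proof (rule AE_I2)
      fix t
      have "eventually (\<lambda>n. half_indicator (- real n) (b + inverse (real (Suc n))) t = indicator {..b} t) sequentially"
      proof (cases "t \<le> b")
        case True
        have "eventually (\<lambda>n. real n > - t) sequentially" by real_asymp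
        then show ?thesis
        proof eventually_elim
          case (elim n)
          have "inverse (real (Suc n)) > 0" by simp
          then have "t < b + inverse (real (Suc n))" using True by linarith
          then show ?case using elim True by (simp add: half_indicator_def)
        qed
      next
        case False
        have "eventually (\<lambda>n. inverse (real (Suc n)) < t - b) sequentially" using False by real_asymp
        then show ?thesis
          by eventually_elim (use False in \<open>simp add: half_indicator_def indicator_def\<close>)
      qed
      then show "(\<lambda>n. half_indicator (- real n) (b + inverse (real (Suc n))) t) \<longlonglongrightarrow> indicator {..b} t"
        by (rule tendsto_eventually)
    qed
    show "AE t in Q. norm (half_indicator (- real n) (b + inverse (real (Suc n))) t) \<le> 1" for n
      by (auto simp: half_indicator_def indicator_def)
  qed simp_all
  then show ?thesis by simp
qed

text \<open>The measures may differ while their differences agree, so Dynkin's induction runs on the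
  differences. Complements need the mass of the whole line, which is not a half-line and is supplied
  by a limit.\<close>

lemma measure_difference_eqI:
  fixes Q R Q' R' :: "real measure"
  assumes fin: "finite_measure Q" "finite_measure R" "finite_measure Q'" "finite_measure R'"
    and sets: "sets Q = sets borel" "sets R = sets borel" "sets Q' = sets borel" "sets R' = sets borel"
    and eq: "\<And>b. measure Q {..b} - measure R {..b} = measure Q' {..b} - measure R' {..b}"
    and E: "E \<in> sets borel"
  shows "measure Q E - measure R E = measure Q' E - measure R' E"
proof -
  interpret Q: finite_measure Q by fact
  interpret R: finite_measure R by fact
  interpret Q': finite_measure Q' by fact
  interpret R': finite_measure R' by fact
  note [simp] = sets
  have sp [simp]: "space Q = UNIV" "space R = UNIV" "space Q' = UNIV" "space R' = UNIV"
    using sets_eq_imp_space_eq[OF sets(1)] sets_eq_imp_space_eq[OF sets(2)]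
      sets_eq_imp_space_eq[OF sets(3)] sets_eq_imp_space_eq[OF sets(4)] by simp_all
  have sb: "sigma_sets UNIV (range atMost) = (sets borel :: real set set)"
    by (subst borel_eq_atMost) simp
  have univ: "measure Q UNIV - measure R UNIV = measure Q' UNIV - measure R' UNIV"
  proof -
    have U: "(\<Union>n. {..real n}) = UNIV" using real_arch_simple by auto
    have inc: "incseq (\<lambda>n. {..real n})" by (auto simp: incseq_def)
    have "(\<lambda>n. measure Q {..real n} - measure R {..real n}) \<longlonglongrightarrow> measure Q UNIV - measure R UNIV"
      unfolding U[symmetric] by (intro tendsto_diff Q.finite_Lim_measure_incseq R.finite_Lim_measure_incseq inc) auto
    moreover have "(\<lambda>n. measure Q' {..real n} - measure R' {..real n}) \<longlonglongrightarrow> measure Q' UNIV - measure R' UNIV"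
      unfolding U[symmetric] by (intro tendsto_diff Q'.finite_Lim_measure_incseq R'.finite_Lim_measure_incseq inc) auto
    ultimately show ?thesis unfolding eq by (rule LIMSEQ_unique)
  qed
  have "Int_stable (range atMost :: real set set)" "range atMost \<subseteq> Pow (UNIV :: real set)"
    "E \<in> sigma_sets UNIV (range atMost)"
    using E sb by (auto simp: Int_stable_def)
  then show ?thesis
  proof (induction rule: sigma_sets_induct_disjoint)
    case (compl A)
    then have [measurable]: "A \<in> sets borel" using sb by blast
    have c: "measure M (UNIV - A) = measure M UNIV - measure M A"
      if "finite_measure M" "sets M = sets borel" "space M = UNIV" for M :: "real measure"
      using finite_measure.finite_measure_compl[OF that(1), of A] that by simp
    show ?case
      using compl(2) univ c[OF fin(1) sets(1) sp(1)] c[OF fin(2) sets(2) sp(2)]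
        c[OF fin(3) sets(3) sp(3)] c[OF fin(4) sets(4) sp(4)] by simp
  next
    case (union A)
    then have r: "range A \<subseteq> sets borel" using sb by blast
    have "(\<lambda>i. measure Q (A i) - measure R (A i)) sums (measure Q (\<Union> (range A)) - measure R (\<Union> (range A)))"
      using union(1) r by (intro sums_diff Q.finite_measure_UNION R.finite_measure_UNION) auto
    moreover have "(\<lambda>i. measure Q' (A i) - measure R' (A i)) sums (measure Q' (\<Union> (range A)) - measure R' (\<Union> (range A)))"
      using union(1) r by (intro sums_diff Q'.finite_measure_UNION R'.finite_measure_UNION) auto
    ultimately show ?case unfolding union(3) by (rule sums_unique2)
  qed (auto simp: eq)
qed

lemma finite_measure_density_real:
  fixes f :: "real \<Rightarrow> real"
  assumes "integrable lborel f" "\<And>x. f x \<ge> 0"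
  shows "finite_measure (density lborel f)"
    and "E \<in> sets borel \<Longrightarrow> measure (density lborel f) E = (LINT x:E|lborel. f x)"
    and "h \<in> borel_measurable borel \<Longrightarrow> (LINT x|density lborel f. h x :: real) = (LINT x|lborel. f x * h x)"
proof -
  note [measurable] = borel_measurable_integrable[OF assms(1)]
  have e: "emeasure (density lborel f) E = ennreal (LINT x:E|lborel. f x)" if "E \<in> sets borel" for E
  proof -
    note [measurable] = that
    have "emeasure (density lborel f) E = (\<integral>\<^sup>+x. ennreal (indicator E x * f x) \<partial>lborel)"
      by (subst emeasure_density) (auto intro!: nn_integral_cong simp: indicator_def)
    also have "\<dots> = ennreal (LINT x|lborel. indicator E x * f x)"
      using assms by (intro nn_integral_eq_integral integrable_mult_indicator[where 'b = real, simplified]) auto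
    finally show ?thesis by (simp add: set_lebesgue_integral_def)
  qed
  show "finite_measure (density lborel f)"
    using e[of UNIV] by (intro finite_measureI) simp
  show "measure (density lborel f) E = (LINT x:E|lborel. f x)" if "E \<in> sets borel"
    unfolding measure_def e[OF that] using assms(2)
    by (simp add: set_lebesgue_integral_def)
  show "(LINT x|density lborel f. h x) = (LINT x|lborel. f x * h x)" if "h \<in> borel_measurable borel"
    using that assms(2) by (subst integral_density) auto
qed

text \<open>The positive and negative parts of the density make the right-hand side a difference of
  two finite measures as well. For these the end points of an interval are null, so the half weights
  are invisible and distribution functions can be compared.\<close>

lemma signed_density_by_intervals:
  fixes Q R :: "real measure" and \<rho> :: "real \<Rightarrow> real"
  assumes "finite_measure Q" "finite_measure R" "sets Q = sets borel" "sets R = sets borel"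
    and \<rho>: "integrable lborel \<rho>"
    and eq: "\<And>c d. c < d \<Longrightarrow> (LINT t|Q. half_indicator c d t) - (LINT t|R. half_indicator c d t) =
      (LINT x|lborel. indicator {c..d} x * \<rho> x)"
    and E: "E \<in> sets borel"
  shows "measure Q E - measure R E = (LINT x:E|lborel. \<rho> x)"
proof -
  define p where "p = (\<lambda>x. max 0 (\<rho> x))"
  define m where "m = (\<lambda>x. max 0 (- \<rho> x))"
  have int: "integrable lborel p" "integrable lborel m"
    unfolding p_def m_def using \<rho> by (auto intro!: integrable_max)
  have nn: "\<And>x. p x \<ge> 0" "\<And>x. m x \<ge> 0" by (auto simp: p_def m_def)
  have pm: "\<rho> x = p x - m x" for x by (auto simp: p_def m_def)
  note P = finite_measure_density_real[OF int(1) nn(1)] and M = finite_measure_density_real[OF int(2) nn(2)]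
  have half_meas: "half_indicator c d \<in> borel_measurable borel" for c d
    unfolding half_indicator_def by measurable
  have half: "(LINT t|density lborel p. half_indicator c d t) - (LINT t|density lborel m. half_indicator c d t) =
      (LINT x|lborel. indicator {c..d} x * \<rho> x)" if "c < d" for c d
  proof -
    have ih: "integrable lborel (\<lambda>x. f x * half_indicator c d x)" if "integrable lborel f" for f
      using half_meas
      by (rule_tac Bochner_Integration.integrable_bound[OF that])
        (use that in \<open>auto simp: half_indicator_def indicator_def abs_mult intro!: AE_I2\<close>)
    have "(LINT t|density lborel p. half_indicator c d t) - (LINT t|density lborel m. half_indicator c d t) =
        (LINT x|lborel. p x * half_indicator c d x - m x * half_indicator c d x)"
      using ih int half_meas by (simp add: P(3) M(3))
    also have "\<dots> = (LINT x|lborel. indicator {c..d} x * \<rho> x)"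
    proof (rule integral_cong_AE)
      have "AE x in lborel. x \<noteq> c \<and> x \<noteq> d"
        using AE_lborel_singleton[of c] AE_lborel_singleton[of d] by eventually_elim auto
      then show "AE x in lborel. p x * half_indicator c d x - m x * half_indicator c d x = indicator {c..d} x * \<rho> x"
        by eventually_elim (auto simp: half_indicator_def indicator_def pm)
    qed (use ih int borel_measurable_integrable[OF \<rho>] in \<open>auto intro!: borel_measurable_integrable Bochner_Integration.integrable_diff\<close>)
    finally show ?thesis .
  qed
  have "measure Q {..b} - measure R {..b} = measure (density lborel p) {..b} - measure (density lborel m) {..b}" for b
  proof -
    let ?h = "\<lambda>n. half_indicator (- real n) (b + inverse (real (Suc n)))"
    have 1: "(\<lambda>n. (LINT t|Q. ?h n t) - (LINT t|R. ?h n t)) \<longlonglongrightarrow> measure Q {..b} - measure R {..b}"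
      using assms by (intro tendsto_diff half_indicator_cdf) auto
    have 2: "(\<lambda>n. (LINT t|density lborel p. ?h n t) - (LINT t|density lborel m. ?h n t))
        \<longlonglongrightarrow> measure (density lborel p) {..b} - measure (density lborel m) {..b}"
      using P(1) M(1) by (intro tendsto_diff half_indicator_cdf) auto
    have 3: "eventually (\<lambda>n. (LINT t|Q. ?h n t) - (LINT t|R. ?h n t) =
        (LINT t|density lborel p. ?h n t) - (LINT t|density lborel m. ?h n t)) sequentially"
    proof -
      have "eventually (\<lambda>n. - real n < b + inverse (real (Suc n))) sequentially" by real_asymp
      then show ?thesis by eventually_elim (simp add: eq half)
    qed
    show ?thesis
      by (rule LIMSEQ_unique[OF Lim_transform_eventually[OF 1 3] 2])
  qed
  then have "measure Q E - measure R E = measure (density lborel p) E - measure (density lborel m) E"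
    using assms P(1) M(1) by (intro measure_difference_eqI[OF _ _ _ _ _ _ _ _ _ E]) auto
  also have "\<dots> = (LINT x:E|lborel. p x - m x)"
  proof -
    have "set_integrable lborel E f" if "integrable lborel f" for f :: "real \<Rightarrow> real"
      unfolding set_integrable_def using E that by (intro integrable_mult_indicator) auto
    then show ?thesis
      using int E by (subst set_integral_diff(2)) (auto simp: P(2) M(2))
  qed
  finally show ?thesis by (simp add: pm)
qed

text \<open>Domination up to the real axis lets the limit pass under the integral over every bounded
  interval; this is what excludes a singular part. On the supporting interval it also bounds \<rho>
  and so makes it integrable.\<close>

lemma stieltjes_density:
  fixes \<nu> :: "real set \<Rightarrow> real" and G :: "complex \<Rightarrow> complex" and \<rho> :: "real \<Rightarrow> real"
  assumes G: "\<And>z. z \<notin> \<real> \<Longrightarrow> has_real_measure_integral \<nu> (\<lambda>x. 1 / (z - complex_of_real x)) (G z)"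
    and meas: "\<rho> \<in> borel_measurable borel"
    and supp: "c0 < d0" "\<And>x. x \<notin> {c0..d0} \<Longrightarrow> \<rho> x = 0"
    and lim: "AE x in lborel. (\<lambda>n. - Im (G (Complex x (inverse (real (Suc n))))) / pi) \<longlonglongrightarrow> \<rho> x"
    and dom: "\<And>c d. c < d \<Longrightarrow> \<exists>w. integrable lborel (\<lambda>x. indicator {c..d} x * w x) \<and>
      (AE x in lborel. x \<in> {c..d} \<longrightarrow> (\<forall>n. cmod (G (Complex x (inverse (real (Suc n))))) \<le> w x))"
  shows "absolutely_continuous_with_density \<nu> \<rho>"
proof -
  have le_norm: "\<bar>- Im y / pi\<bar> \<le> cmod y" for y
  proof -
    have "\<bar>Im y\<bar> / pi \<le> \<bar>Im y\<bar> / 1" using pi_gt3 by (intro divide_left_mono) auto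
    also have "\<dots> \<le> cmod y" using abs_Im_le_cmod[of y] by simp
    finally show ?thesis by simp
  qed
  have \<rho>: "integrable lborel \<rho>"
  proof -
    obtain w where w: "integrable lborel (\<lambda>x. indicator {c0..d0} x * w x)"
      and b: "AE x in lborel. x \<in> {c0..d0} \<longrightarrow> (\<forall>n. cmod (G (Complex x (inverse (real (Suc n))))) \<le> w x)"
      using dom[OF supp(1)] by blast
    show ?thesis
    proof (rule Bochner_Integration.integrable_bound[OF w])
      show "AE x in lborel. norm (\<rho> x) \<le> norm (indicator {c0..d0} x * w x)"
        using lim b
      proof eventually_elim
        case (elim x)
        show ?case
        proof (cases "x \<in> {c0..d0}")
          case True
          with elim(2) have b: "\<bar>- Im (G (Complex x (inverse (real (Suc n))))) / pi\<bar> \<le> w x" for n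
            using le_norm[of "G (Complex x (inverse (real (Suc n))))"] by (blast intro: order_trans)
          have "\<bar>\<rho> x\<bar> \<le> w x"
            by (rule LIMSEQ_le_const2[OF tendsto_rabs[OF elim(1)]]) (use b in blast)
          with True show ?thesis by simp
        qed (simp add: supp)
      qed
    qed (use meas in simp)
  qed
  \<comment> \<open>The point i merely fixes a pair \<open>Q\<close>, \<open>R\<close>; uniqueness
    extends the formula to all other non-real points.\<close>
  have "\<i> \<notin> \<real>" by (auto simp: complex_is_Real_iff)
  from G[OF this] obtain Q R where J: "jordan_decomposition \<nu> Q R"
    unfolding has_real_measure_integral_def by blast
  have fin: "finite_measure Q" "finite_measure R" and sets: "sets Q = sets borel" "sets R = sets borel"
    using J unfolding jordan_decomposition_def by blast+
  have GQR: "integrable Q (\<lambda>x. 1 / (z - complex_of_real x))" "integrable R (\<lambda>x. 1 / (z - complex_of_real x))"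
    "G z = (LINT x|Q. 1 / (z - complex_of_real x)) - (LINT x|R. 1 / (z - complex_of_real x))" if "z \<notin> \<real>" for z
    using G[OF that] jordan_decomposition_unique[OF J] unfolding has_real_measure_integral_def by blast+
  let ?e = "\<lambda>n. inverse (real (Suc n))"
  let ?F = "\<lambda>n x. - Im (G (Complex x (?e n))) / pi"
  have F: "?F n x = (LINT t|Q. poisson (?e n) x t) - (LINT t|R. poisson (?e n) x t)" for n x
  proof -
    have nr: "Complex x (?e n) \<notin> \<real>" by (simp add: complex_is_Real_iff)
    have e: "?e n > 0" by simp
    note g = GQR[OF nr]
    have "(LINT t|M. poisson (?e n) x t) = - Im (LINT t|M. 1 / (Complex x (?e n) - complex_of_real t)) / pi"
      if "integrable M (\<lambda>t. 1 / (Complex x (?e n) - complex_of_real t))" for M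
      unfolding poisson_eq_Im[OF e] using that by (simp del: Im_divide_of_real add: Im_divide_of_real)
    from this[OF g(1)] this[OF g(2)] show ?thesis unfolding g(3) by (simp add: diff_divide_distrib)
  qed
  have "(LINT t|Q. half_indicator c d t) - (LINT t|R. half_indicator c d t) =
      (LINT x|lborel. indicator {c..d} x * \<rho> x)" if cd: "c < d" for c d
  proof -
    note SQ = stieltjes_inversion_positive[OF fin(1) sets(1) cd]
      and SR = stieltjes_inversion_positive[OF fin(2) sets(2) cd]
    have "(LINT x|lborel. indicator {c..d} x * ?F n x) =
        (LINT x|lborel. indicator {c..d} x * (LINT t|Q. poisson (?e n) x t)) -
        (LINT x|lborel. indicator {c..d} x * (LINT t|R. poisson (?e n) x t))" for n
      unfolding F right_diff_distrib
      by (rule Bochner_Integration.integral_diff[OF SQ(2) SR(2)])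
    then have "(\<lambda>n. LINT x|lborel. indicator {c..d} x * ?F n x) \<longlonglongrightarrow>
        (LINT t|Q. half_indicator c d t) - (LINT t|R. half_indicator c d t)"
      using tendsto_diff[OF SQ(3) SR(3)] by simp
    moreover have "(\<lambda>n. LINT x|lborel. indicator {c..d} x * ?F n x) \<longlonglongrightarrow> (LINT x|lborel. indicator {c..d} x * \<rho> x)"
    proof -
      obtain w where w: "integrable lborel (\<lambda>x. indicator {c..d} x * w x)"
        and b: "AE x in lborel. x \<in> {c..d} \<longrightarrow> (\<forall>n. cmod (G (Complex x (?e n))) \<le> w x)"
        using dom[OF cd] by blast
      show ?thesis
      proof (rule integral_dominated_convergence[OF _ _ w])
        show "(\<lambda>x. indicator {c..d} x * \<rho> x) \<in> borel_measurable lborel"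
          using borel_measurable_integrable[OF \<rho>] by measurable
        show "(\<lambda>x. indicator {c..d} x * ?F n x) \<in> borel_measurable lborel" for n
          unfolding F using SQ(1)[of n] SR(1)[of n] by measurable
        show "AE x in lborel. (\<lambda>n. indicator {c..d} x * ?F n x) \<longlonglongrightarrow> indicator {c..d} x * \<rho> x"
          using lim by eventually_elim (intro tendsto_intros)
        show "AE x in lborel. norm (indicator {c..d} x * ?F n x) \<le> indicator {c..d} x * w x" for n
          using b
        proof eventually_elim
          case (elim x)
          note le_norm[of "G (Complex x (?e n))"]
          with elim show ?case by (cases "x \<in> {c..d}") (auto simp: abs_mult intro: order_trans)
        qed
      qed
    qed
    ultimately show ?thesis by (rule LIMSEQ_unique)
  qed
  then have "measure Q E - measure R E = (LINT x:E|lborel. \<rho> x)" if "E \<in> sets borel" for E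
    using signed_density_by_intervals[OF fin sets \<rho> _ that] by blast
  moreover have "\<nu> E = measure Q E - measure R E" if "E \<in> sets borel" for E
    using J that unfolding jordan_decomposition_def by blast
  ultimately show ?thesis
    unfolding absolutely_continuous_with_density_def using \<rho> by simp
qed

section \<open>Real-rooted polynomials and the bands\<close>

text \<open>The zero polynomial is excluded explicitly: \<open>proots 0\<close> is empty and
  \<open>degree 0\<close> is 0, so the count alone would accept it.\<close>

definition real_rooted :: "real poly \<Rightarrow> bool" where
  "real_rooted p \<longleftrightarrow> p \<noteq> 0 \<and> size (proots p) = degree p"

lemma real_rooted_factorization:
  assumes "real_rooted p"
  shows "p = smult (lead_coeff p) (\<Prod>r\<in>#proots p. [:- r, 1:])"
  using assms
proof (induction "degree p" arbitrary: p)
  case 0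
  then obtain c where "p = [:c:]" "c \<noteq> 0" by (auto simp: real_rooted_def elim: degree_eq_zeroE)
  then show ?case by simp
next
  case (Suc n)
  then have p0: "p \<noteq> 0" and sz: "size (proots p) = Suc n" by (auto simp: real_rooted_def)
  then obtain r where "r \<in># proots p" by (metis size_eq_Suc_imp_elem)
  then have "poly p r = 0" using p0 by simp
  then obtain q where q: "p = [:- r, 1:] * q" by (metis dvdE poly_eq_0_iff_dvd)
  with p0 have q0: "q \<noteq> 0" by auto
  have pr: "proots p = {#r#} + proots q"
    unfolding q using q0 by (subst proots_mult) auto
  have dq: "degree p = Suc (degree q)" unfolding q using q0 by (subst degree_mult_eq) auto
  then have "real_rooted q" "n = degree q"
    using sz pr Suc.hyps(2) q0 by (auto simp: real_rooted_def)
  then have IH: "q = smult (lead_coeff q) (\<Prod>r\<in>#proots q. [:- r, 1:])"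
    using Suc.hyps(1) by blast
  have "lead_coeff p = lead_coeff q" unfolding q by (simp only: lead_coeff_mult) simp
  then have "smult (lead_coeff p) (\<Prod>r\<in>#proots p. [:- r, 1:]) =
      [:- r, 1:] * smult (lead_coeff q) (\<Prod>r\<in>#proots q. [:- r, 1:])"
    unfolding pr by (simp only: image_mset_union image_mset_single prod_mset_Un prod_mset_singleton mult_smult_right)
  then show ?case using IH q by simp
qed

lemma rpoly_real_rooted:
  assumes "real_rooted p"
  shows "rpoly p z = of_real (lead_coeff p) * (\<Prod>r\<in>#proots p. z - of_real r)"
proof -
  have "rpoly p z = rpoly (smult (lead_coeff p) (\<Prod>r\<in>#proots p. [:- r, 1:])) z"
    using real_rooted_factorization[OF assms] by simp
  then show ?thesis by (simp add: rpoly_prod_mset)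
qed

lemma real_rooted_nonzero:
  assumes "real_rooted p" "Im z \<noteq> 0"
  shows "rpoly p z \<noteq> 0"
proof -
  have "p \<noteq> 0" using assms(1) by (simp add: real_rooted_def)
  have "z \<noteq> complex_of_real r" for r using assms(2) by auto
  with \<open>p \<noteq> 0\<close> show ?thesis by (auto simp: rpoly_real_rooted[OF assms(1)])
qed

text \<open>Moving off the real axis does not decrease the distance to any real root. This is the
  source of estimates independent of the height.\<close>

lemma real_rooted_norm_ge:
  assumes "real_rooted p"
  shows "\<bar>poly p x\<bar> \<le> cmod (rpoly p (Complex x y))"
proof -
  have "\<bar>\<Prod>r\<in>#M. x - r\<bar> \<le> cmod (\<Prod>r\<in>#M. Complex x y - of_real r)" for M
  proof (induction M)
    case (add r M)
    have "\<bar>x - r\<bar> \<le> cmod (Complex x y - of_real r)"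
      using abs_Re_le_cmod[of "Complex x y - of_real r"] by simp
    with add show ?case by (auto simp: abs_mult norm_mult intro: mult_mono)
  qed simp
  from this[of "proots p"] show ?thesis
    using rpoly_real_rooted[OF assms, of "Complex x y"] rpoly_real_rooted[OF assms, of x]
    by (simp add: rpoly_real norm_mult abs_mult mult_left_mono)
qed

text \<open>Root counts and degrees both add, and neither factor can have more roots than its
  degree.\<close>

lemma real_rooted_mult:
  assumes "real_rooted (p * q)"
  shows "real_rooted p" "real_rooted q"
proof -
  have nz: "p \<noteq> 0" "q \<noteq> 0" using assms by (auto simp: real_rooted_def)
  then have "size (proots p) + size (proots q) = degree p + degree q"
    using assms by (simp add: real_rooted_def proots_mult degree_mult_eq)
  then show "real_rooted p" "real_rooted q"
    using nz size_proots_le[of p] size_proots_le[of q] by (auto simp: real_rooted_def)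
qed

text \<open>A substitute for partial fractions: for distinct r and s, the inequality sqrt |s - r| <=
  sqrt |x - r| + sqrt |x - s| turns a product of two singular terms into a constant times their sum.
  Only the integrable singularities |x - r|^(-1/2) remain.\<close>

lemma inverse_sqrt_prod_bound:
  fixes F :: "real set"
  assumes "finite F"
  shows "\<exists>C\<ge>0. \<forall>x. 1 / sqrt (\<Prod>r\<in>F. \<bar>x - r\<bar>) \<le> C * (1 + (\<Sum>r\<in>F. 1 / sqrt \<bar>x - r\<bar>))"
  using assms
proof (induction F rule: finite_induct)
  case empty
  then show ?case by (auto intro: exI[of _ 1])
next
  case (insert s F)
  then obtain C where C: "C \<ge> 0" and IH: "\<And>x. 1 / sqrt (\<Prod>r\<in>F. \<bar>x - r\<bar>) \<le> C * (1 + (\<Sum>r\<in>F. 1 / sqrt \<bar>x - r\<bar>))"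
    by blast
  define h where "h = (\<lambda>r x. 1 / sqrt \<bar>x - r\<bar> :: real)"
  define d where "d = (\<lambda>r. 1 / sqrt \<bar>s - r\<bar>)"
  have h0: "h r x \<ge> 0" and d0: "d r \<ge> 0" for r x by (auto simp: h_def d_def)
  have hh: "h r x * h s x \<le> d r * (h r x + h s x)" if "r \<noteq> s" for r x
  proof (cases "x = r \<or> x = s")
    case True
    \<comment> \<open>The convention 1 / 0 = 0 makes the product vanish at the singular
      points.\<close>
    then have "h r x * h s x = 0" by (auto simp: h_def)
    moreover have "0 \<le> d r * (h r x + h s x)" using h0 d0 by simp
    ultimately show ?thesis by linarith
  next
    case False
    have "sqrt \<bar>s - r\<bar> \<le> sqrt (\<bar>x - r\<bar> + \<bar>x - s\<bar>)" by simp
    also have "\<dots> \<le> sqrt \<bar>x - r\<bar> + sqrt \<bar>x - s\<bar>" by (rule sqrt_add_le_add_sqrt) auto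
    finally show ?thesis
      using False that unfolding h_def d_def by (simp add: divide_simps)
  qed
  define S where "S = (\<Sum>r\<in>F. d r)"
  have S0: "S \<ge> 0" unfolding S_def using d0 by (intro sum_nonneg) auto
  have "1 / sqrt (\<Prod>r\<in>insert s F. \<bar>x - r\<bar>) \<le> C * (1 + S) * (1 + (\<Sum>r\<in>insert s F. 1 / sqrt \<bar>x - r\<bar>))" for x
  proof -
    have "1 / sqrt (\<Prod>r\<in>insert s F. \<bar>x - r\<bar>) = 1 / sqrt (\<Prod>r\<in>F. \<bar>x - r\<bar>) * h s x"
      using insert by (simp add: real_sqrt_mult h_def)
    also have "\<dots> \<le> C * (1 + (\<Sum>r\<in>F. h r x)) * h s x"
      using IH[of x] h0 unfolding h_def by (intro mult_right_mono) auto
    also have "\<dots> = C * (h s x + (\<Sum>r\<in>F. h r x * h s x))"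
      by (simp add: algebra_simps sum_distrib_left)
    also have "\<dots> \<le> C * (h s x + (\<Sum>r\<in>F. S * h r x + d r * h s x))"
    proof -
      have "h r x * h s x \<le> S * h r x + d r * h s x" if "r \<in> F" for r
      proof -
        have "d r \<le> S" unfolding S_def using that d0 insert by (intro member_le_sum) auto
        then have "d r * h r x \<le> S * h r x" using h0 by (intro mult_right_mono) auto
        moreover have "r \<noteq> s" using that insert by auto
        ultimately show ?thesis using hh[of r x] by (simp add: algebra_simps)
      qed
      then show ?thesis using C by (intro mult_left_mono add_left_mono sum_mono) auto
    qed
    also have "\<dots> = C * ((1 + S) * h s x + S * (\<Sum>r\<in>F. h r x))"
      by (simp add: S_def sum.distrib sum_distrib_left sum_distrib_right algebra_simps)
    also have "\<dots> \<le> C * ((1 + S) * (1 + (h s x + (\<Sum>r\<in>F. h r x))))"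
    proof -
      have "0 \<le> (\<Sum>r\<in>F. h r x)" using h0 by (intro sum_nonneg) auto
      then show ?thesis using C S0 by (intro mult_left_mono) (auto simp: algebra_simps)
    qed
    finally show ?thesis using insert by (simp add: h_def mult.assoc)
  qed
  then show ?case using C S0 by (intro exI[of _ "C * (1 + S)"]) auto
qed

text \<open>Translation and reflection reduce both sides of the singularity to
  \<open>x powr (- 1/2)\<close> on [0, L], where \<open>L\<close> is at least |x - r| for every x in
  [c, d].\<close>

lemma integrable_inverse_sqrt_Icc:
  "integrable lborel (\<lambda>x. indicator {c..d} x * (1 / sqrt \<bar>x - r\<bar>) :: real)"
proof -
  define L where "L = \<bar>c\<bar> + \<bar>d\<bar> + \<bar>r\<bar>"
  define k where "k = (\<lambda>x :: real. indicator {0..L} x * x powr (- 1/2))"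
  have "(\<lambda>x. x powr (- 1/2)) absolutely_integrable_on {0..L}"
    by (intro nonnegative_absolutely_integrable_1 integrable_on_powr_from_0) (auto simp: L_def)
  then have "integrable (completion lborel) k"
    by (simp add: set_integrable_def k_def)
  moreover have [measurable]: "k \<in> borel_measurable borel"
    unfolding k_def by measurable
  ultimately have k: "integrable lborel k"
    by (subst (asm) integrable_completion) auto
  have "integrable lborel (\<lambda>x. k (- r + 1 * x) + k (r + (- 1) * x))"
    by (intro Bochner_Integration.integrable_add lborel_integrable_real_affine k) auto
  then show ?thesis
  proof (rule Bochner_Integration.integrable_bound)
    show "AE x in lborel. norm (indicator {c..d} x * (1 / sqrt \<bar>x - r\<bar>)) \<le> norm (k (- r + 1 * x) + k (r + (- 1) * x))"
    proof (rule AE_I2)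
      fix x
      have kn: "k y \<ge> 0" for y by (simp add: k_def)
      have kv: "k y = 1 / sqrt y" if "0 < y" "y \<le> L" for y
        using that by (simp add: k_def powr_minus_divide powr_half_sqrt)
      show "norm (indicator {c..d} x * (1 / sqrt \<bar>x - r\<bar>)) \<le> norm (k (- r + 1 * x) + k (r + (- 1) * x))"
      proof (cases "x \<in> {c..d} \<and> x \<noteq> r")
        case True
        then consider "x - r > 0" "x - r \<le> L" | "r - x > 0" "r - x \<le> L"
          unfolding L_def by (cases "x > r") auto
        then show ?thesis
          using True kv[of "x - r"] kv[of "r - x"] kn[of "x - r"] kn[of "r - x"]
          by cases (auto simp: abs_minus_commute)
      qed auto
    qed
  qed measurable
qed

lemma measurable_poly [measurable]: "poly p \<in> borel_measurable (borel :: real measure)" for p :: "real poly"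
  by (intro borel_measurable_continuous_onI continuous_on_poly continuous_on_id)

text \<open>Simplicity gives every root order 1, so |p| is a constant times the product over
  distinct roots that \<open>inverse_sqrt_prod_bound\<close> treats. A double root would produce the
  non-integrable 1 / |x - r|.\<close>

lemma integrable_inverse_sqrt_real_rooted:
  assumes p: "real_rooted p" and simple: "\<And>x. poly p x = 0 \<Longrightarrow> poly (pderiv p) x \<noteq> 0"
  shows "integrable lborel (\<lambda>x. indicator {c..d} x * (1 / sqrt \<bar>poly p x\<bar>))"
proof -
  let ?F = "{x. poly p x = 0}"
  have p0: "p \<noteq> 0" using p by (simp add: real_rooted_def)
  have fin: "finite ?F" by (rule poly_roots_finite[OF p0])
  have "proots p = mset_set ?F"
  proof (rule multiset_eqI)
    fix r
    show "count (proots p) r = count (mset_set ?F) r"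
    proof (cases "poly p r = 0")
      case True
      then have "order r p = 1"
        using order_pderiv[OF p0 True] simple[OF True] by (simp add: order_0I)
      then show ?thesis using p0 fin True by simp
    qed (use p0 fin in \<open>simp add: order_0I\<close>)
  qed
  then have pp: "\<bar>poly p x\<bar> = \<bar>lead_coeff p\<bar> * (\<Prod>r\<in>?F. \<bar>x - r\<bar>)" for x
    using rpoly_real_rooted[OF p, of x]
    by (simp add: rpoly_real abs_mult prod_unfold_prod_mset[symmetric] abs_prod)
  obtain C where C: "C \<ge> 0" "\<And>x. 1 / sqrt (\<Prod>r\<in>?F. \<bar>x - r\<bar>) \<le> C * (1 + (\<Sum>r\<in>?F. 1 / sqrt \<bar>x - r\<bar>))"
    using inverse_sqrt_prod_bound[OF fin] by blast
  define K where "K = 1 / sqrt \<bar>lead_coeff p\<bar>"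
  have "integrable lborel (\<lambda>x. K * C * (indicator {c..d} x + (\<Sum>r\<in>?F. indicator {c..d} x * (1 / sqrt \<bar>x - r\<bar>))))"
    by (intro integrable_mult_right Bochner_Integration.integrable_add Bochner_Integration.integrable_sum
        integrable_inverse_sqrt_Icc integrable_real_indicator) (auto simp: emeasure_lborel_Icc_eq)
  then show ?thesis
  proof (rule Bochner_Integration.integrable_bound)
    show "(\<lambda>x. indicator {c..d} x * (1 / sqrt \<bar>poly p x\<bar>)) \<in> borel_measurable lborel"
      using measurable_poly[of p] by measurable
    show "AE x in lborel. norm (indicator {c..d} x * (1 / sqrt \<bar>poly p x\<bar>)) \<le>
        norm (K * C * (indicator {c..d} x + (\<Sum>r\<in>?F. indicator {c..d} x * (1 / sqrt \<bar>x - r\<bar>))))"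
    proof (rule AE_I2)
      fix x
      have "1 / sqrt \<bar>poly p x\<bar> = K * (1 / sqrt (\<Prod>r\<in>?F. \<bar>x - r\<bar>))"
        unfolding pp K_def by (simp add: real_sqrt_mult)
      also have "\<dots> \<le> K * (C * (1 + (\<Sum>r\<in>?F. 1 / sqrt \<bar>x - r\<bar>)))"
        by (rule mult_left_mono[OF C(2)]) (simp add: K_def)
      finally have "1 / sqrt \<bar>poly p x\<bar> \<le> \<bar>K * (C * (1 + (\<Sum>r\<in>?F. 1 / sqrt \<bar>x - r\<bar>)))\<bar>" by linarith
      then show "norm (indicator {c..d} x * (1 / sqrt \<bar>poly p x\<bar>)) \<le>
        norm (K * C * (indicator {c..d} x + (\<Sum>r\<in>?F. indicator {c..d} x * (1 / sqrt \<bar>x - r\<bar>))))"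
        by (cases "x \<in> {c..d}") (simp_all add: mult.assoc)
    qed
  qed
qed

text \<open>From (Im X)^2 = (|X^2| - Re (X^2)) / 2 the square determines |Im X| continuously, and
  the sign condition then determines Im X. Nothing is claimed about Re X, whose sign may
  oscillate.\<close>

lemma tendsto_Im_of_square:
  fixes X :: "nat \<Rightarrow> complex"
  assumes lim: "(\<lambda>n. (X n)\<^sup>2) \<longlonglongrightarrow> of_real t" and neg: "\<And>n. Im (X n) \<le> 0"
  shows "(\<lambda>n. Im (X n)) \<longlonglongrightarrow> - sqrt ((\<bar>t\<bar> - t) / 2)"
proof -
  have "Im (X n) = - sqrt ((cmod ((X n)\<^sup>2) - Re ((X n)\<^sup>2)) / 2)" for n
  proof -
    have "(cmod ((X n)\<^sup>2) - Re ((X n)\<^sup>2)) / 2 = (Im (X n))\<^sup>2"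
      by (simp add: norm_power cmod_power2) (simp add: power2_eq_square)
    then show ?thesis using neg[of n] by simp
  qed
  moreover have "(\<lambda>n. - sqrt ((cmod ((X n)\<^sup>2) - Re ((X n)\<^sup>2)) / 2)) \<longlonglongrightarrow>
      - sqrt ((cmod (of_real t) - Re (of_real t)) / 2)"
    by (intro tendsto_intros lim) simp
  ultimately show ?thesis by simp
qed

section \<open>Sign of g_N^2 - 1 on the bands and between them\<close>

lemma prod_pairs: "(\<Prod>i\<in>{1..2 * N}. f i) = (\<Prod>k\<in>{1..N}. f (2 * k - 1) * f (2 * k))"
  for f :: "nat \<Rightarrow> real"
proof (induction N)
  case (Suc N)
  have "{1..2 * Suc N} = insert (2 * N + 2) (insert (2 * N + 1) {1..2 * N})" by auto
  then show ?case using Suc by (simp add: mult_ac)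
qed simp

text \<open>The factors with roots \<xi>(2k - 1) and \<xi>(2k) have a negative product only inside
  the k-th band; the order of the roots keeps the bands disjoint, so at most one pair is
  negative.\<close>

lemma bands_sign:
  fixes \<xi> :: "nat \<Rightarrow> real"
  assumes lt: "\<And>k. k \<in> {1..N} \<Longrightarrow> \<xi> (2 * k - 1) < \<xi> (2 * k)"
    and le: "\<And>k. k \<in> {1..<N} \<Longrightarrow> \<xi> (2 * k) \<le> \<xi> (2 * k + 1)"
  shows "x \<in> (\<Union>k\<in>{1..N}. {\<xi> (2 * k - 1)<..<\<xi> (2 * k)}) \<Longrightarrow> (\<Prod>i\<in>{1..2 * N}. x - \<xi> i) \<le> 0"
    and "x \<notin> (\<Union>k\<in>{1..N}. {\<xi> (2 * k - 1)<..<\<xi> (2 * k)}) \<Longrightarrow> (\<Prod>i\<in>{1..2 * N}. x - \<xi> i) \<ge> 0"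
proof -
  let ?f = "\<lambda>k. (x - \<xi> (2 * k - 1)) * (x - \<xi> (2 * k))"
  have nonneg: "?f k \<ge> 0" if "k \<in> {1..N}" "x \<notin> {\<xi> (2 * k - 1)<..<\<xi> (2 * k)}" for k
    using that lt[OF that(1)] by (auto simp: zero_le_mult_iff not_less)
  show "(\<Prod>i\<in>{1..2 * N}. x - \<xi> i) \<ge> 0" if "x \<notin> (\<Union>k\<in>{1..N}. {\<xi> (2 * k - 1)<..<\<xi> (2 * k)})"
    unfolding prod_pairs using that nonneg by (intro prod_nonneg) blast
  have ord: "\<xi> (2 * j) \<le> \<xi> (2 * k - 1)" if "1 \<le> j" "j < k" "k \<le> N" for j k
    using that(2,3)
  proof (induction k)
    case (Suc k)
    have step: "\<xi> (2 * k) \<le> \<xi> (2 * Suc k - 1)" using le[of k] Suc that(1) by simp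
    show ?case
    proof (cases "j = k")
      case False
      then have "\<xi> (2 * j) \<le> \<xi> (2 * k - 1)" using Suc by simp
      also have "\<dots> < \<xi> (2 * k)" using lt[of k] Suc that(1) by simp
      finally show ?thesis using step by simp
    qed (use step in simp)
  qed simp
  show "(\<Prod>i\<in>{1..2 * N}. x - \<xi> i) \<le> 0" if x: "x \<in> (\<Union>k\<in>{1..N}. {\<xi> (2 * k - 1)<..<\<xi> (2 * k)})"
  proof -
    obtain k where k: "k \<in> {1..N}" "x \<in> {\<xi> (2 * k - 1)<..<\<xi> (2 * k)}" using x by blast
    have "?f j \<ge> 0" if "j \<in> {1..N} - {k}" for j
    proof (rule nonneg)
      show "x \<notin> {\<xi> (2 * j - 1)<..<\<xi> (2 * j)}"
        using ord[of j k] ord[of k j] k that by (cases "j < k") auto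
    qed (use that in auto)
    then have "(\<Prod>j\<in>{1..N} - {k}. ?f j) \<ge> 0" by (intro prod_nonneg) blast
    moreover have "?f k \<le> 0" using k by (auto simp: mult_le_0_iff)
    ultimately have "?f k * (\<Prod>j\<in>{1..N} - {k}. ?f j) \<le> 0" by (rule mult_nonpos_nonneg[rotated])
    then show ?thesis unfolding prod_pairs using prod.remove[of "{1..N}" k ?f] k by simp
  qed
qed

text \<open>The degree of g_N^2 - 1 is 2N, the number of roots listed, so no root is left to be
  non-real. Subtracting 1 preserves the leading coefficient because N >= 1.\<close>

lemma gN_square_real_rooted:
  assumes N: "N \<ge> 1"
    and roots: "proots ((gN_poly a N)\<^sup>2 - 1) = image_mset \<xi> (mset_set {1..2 * N})"
  shows "real_rooted ((gN_poly a N)\<^sup>2 - 1)" "lead_coeff ((gN_poly a N)\<^sup>2 - 1) > 0"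
proof -
  let ?g = "gN_poly a N"
  have d: "degree (?g\<^sup>2) = 2 * N" using gN_poly_degree[OF N, of a] by (subst degree_power_eq) auto
  have d1: "degree (?g\<^sup>2 - 1) = 2 * N"
    using degree_add_eq_left[of "- 1" "?g\<^sup>2"] d N by simp
  have "lead_coeff (?g\<^sup>2 - 1) = coeff (?g\<^sup>2) (2 * N) - coeff 1 (2 * N)" unfolding d1 by simp
  also have "\<dots> = (lead_coeff ?g)\<^sup>2"
    using N unfolding d[symmetric] lead_coeff_power by (simp add: coeff_eq_0 d)
  also have "\<dots> > 0" using gN_poly_degree(2)[OF N, of a] by (intro zero_less_power)
  finally show lc: "lead_coeff (?g\<^sup>2 - 1) > 0" .
  then have "?g\<^sup>2 - 1 \<noteq> 0" by auto
  then show "real_rooted (?g\<^sup>2 - 1)"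
    using d1 roots by (simp add: real_rooted_def)
qed

lemma gN_square_bands:
  assumes N: "N \<ge> 1"
    and roots: "proots ((gN_poly a N)\<^sup>2 - 1) = image_mset \<xi> (mset_set {1..2 * N})"
    and lt: "\<And>k. k \<in> {1..N} \<Longrightarrow> \<xi> (2 * k - 1) < \<xi> (2 * k)"
    and le: "\<And>k. k \<in> {1..<N} \<Longrightarrow> \<xi> (2 * k) \<le> \<xi> (2 * k + 1)"
  shows "x \<in> (\<Union>k\<in>{1..N}. {\<xi> (2 * k - 1)<..<\<xi> (2 * k)}) \<Longrightarrow> (poly (gN_poly a N) x)\<^sup>2 \<le> 1"
    and "x \<notin> (\<Union>k\<in>{1..N}. {\<xi> (2 * k - 1)<..<\<xi> (2 * k)}) \<Longrightarrow> (poly (gN_poly a N) x)\<^sup>2 \<ge> 1"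
proof -
  note rr = gN_square_real_rooted[OF N roots]
  have "(poly (gN_poly a N) x)\<^sup>2 - 1 = lead_coeff ((gN_poly a N)\<^sup>2 - 1) * (\<Prod>i\<in>{1..2 * N}. x - \<xi> i)"
    using rpoly_real_rooted[OF rr(1), of x] unfolding roots
    by (simp add: rpoly_real image_mset.compositionality o_def prod_unfold_prod_mset)
  then show "x \<in> (\<Union>k\<in>{1..N}. {\<xi> (2 * k - 1)<..<\<xi> (2 * k)}) \<Longrightarrow> (poly (gN_poly a N) x)\<^sup>2 \<le> 1"
    "x \<notin> (\<Union>k\<in>{1..N}. {\<xi> (2 * k - 1)<..<\<xi> (2 * k)}) \<Longrightarrow> (poly (gN_poly a N) x)\<^sup>2 \<ge> 1"
    using bands_sign[OF lt le, of N x] rr(2)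
    by (smt (verit) mult_nonneg_nonneg mult_nonneg_nonpos)+
qed

section \<open>Boundary values of the Green function\<close>

text \<open>D and s_N divide the real-rooted g_N^2 - 1, so neither vanishes off the real axis and
  \<open>green_entries\<close> applies at every non-real point.\<close>

lemma green_real_rooted:
  assumes N: "N \<ge> 1" and rr: "real_rooted ((gN_poly a N)\<^sup>2 - 1)" and z: "Im z \<noteq> 0"
  obtains m where "m\<^sup>2 = rpoly (disc_poly a N) z / odd_sol a N z (int N)"
    "green a N 0 0 z = - 1 / m"
    "green a N 0 1 z = (z - of_real a) * green a N 0 0 z - 1"
    "green a N 1 1 z = (z - of_real a)\<^sup>2 * green a N 0 0 z + m"
    "Im z > 0 \<Longrightarrow> Im (green a N 0 0 z) \<le> 0"
    "Im z > 0 \<Longrightarrow> Im (green a N 1 1 z) \<le> 0"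
proof -
  have "real_rooted (disc_poly a N)" "real_rooted (odd_poly a N N)"
    using real_rooted_mult rr unfolding gN_poly_square[OF N] by blast+
  then have "rpoly (disc_poly a N) z \<noteq> 0" "odd_sol a N z (int N) \<noteq> 0"
    using z by (auto simp: odd_sol_def dest: real_rooted_nonzero)
  then show ?thesis using green_entries[OF N z] that by blast
qed

text \<open>Only m^2 survives in the squares, so the undetermined sign of \<open>m\<close>
  disappears. Both fractions are brought to the denominator D s_N = g_N^2 - 1.\<close>

lemma green_squares:
  assumes N: "N \<ge> 1" and rr: "real_rooted ((gN_poly a N)\<^sup>2 - 1)" and z: "Im z \<noteq> 0"
  shows "(green a N 0 0 z)\<^sup>2 = (odd_sol a N z (int N))\<^sup>2 / rpoly ((gN_poly a N)\<^sup>2 - 1) z"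
    and "(green a N 1 1 z)\<^sup>2 = (rpoly (Ppoly a N (N - 1)) z)\<^sup>2 / rpoly ((gN_poly a N)\<^sup>2 - 1) z"
proof -
  let ?D = "rpoly (disc_poly a N) z" and ?s = "odd_sol a N z (int N)"
  obtain m where m: "m\<^sup>2 = ?D / ?s" and g: "green a N 0 0 z = - 1 / m"
    "green a N 1 1 z = (z - of_real a)\<^sup>2 * green a N 0 0 z + m"
    using green_real_rooted[OF N rr z] by blast
  have "real_rooted (disc_poly a N)" "real_rooted (odd_poly a N N)"
    using real_rooted_mult rr unfolding gN_poly_square[OF N] by blast+
  then have nz: "?D \<noteq> 0" "?s \<noteq> 0"
    using z by (auto simp: odd_sol_def dest: real_rooted_nonzero)
  then have m0: "m \<noteq> 0" using m by auto
  have p: "rpoly ((gN_poly a N)\<^sup>2 - 1) z = ?D * ?s"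
    unfolding gN_poly_square[OF N] by (simp add: odd_sol_def)
  show "(green a N 0 0 z)\<^sup>2 = ?s\<^sup>2 / rpoly ((gN_poly a N)\<^sup>2 - 1) z"
    unfolding p g(1) power_divide m using nz by (simp add: power2_eq_square)
  have "(green a N 1 1 z)\<^sup>2 = (m\<^sup>2 - (z - of_real a)\<^sup>2)\<^sup>2 / m\<^sup>2"
    unfolding g using m0 by (simp add: field_simps power2_eq_square)
  also have "\<dots> = (?D - (z - of_real a)\<^sup>2 * ?s)\<^sup>2 / (?D * ?s)"
  proof -
    have "?D / ?s - (z - of_real a)\<^sup>2 = (?D - (z - of_real a)\<^sup>2 * ?s) / ?s"
      using nz by (simp add: diff_divide_distrib)
    then show ?thesis unfolding m using nz by (simp add: power_divide power2_eq_square)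
  qed
  also have "\<dots> = (rpoly (Ppoly a N (N - 1)) z)\<^sup>2 / rpoly ((gN_poly a N)\<^sup>2 - 1) z"
    unfolding p rpoly_Ppoly_pred[OF N] by (simp add: power2_commute)
  finally show "(green a N 1 1 z)\<^sup>2 = (rpoly (Ppoly a N (N - 1)) z)\<^sup>2 / rpoly ((gN_poly a N)\<^sup>2 - 1) z" .
qed

lemma tendsto_vertical: "(\<lambda>n. Complex x (inverse (real (Suc n)))) \<longlonglongrightarrow> of_real x"
proof -
  have "(\<lambda>n. Complex x (inverse (real (Suc n)))) \<longlonglongrightarrow> Complex x 0"
    by (intro tendsto_Complex tendsto_const LIMSEQ_inverse_real_of_nat)
  then show ?thesis by (simp add: complex_of_real_def)
qed

lemma rpoly_tendsto_vertical:
  "(\<lambda>n. rpoly p (Complex x (inverse (real (Suc n))))) \<longlonglongrightarrow> complex_of_real (poly p x)"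
  using isCont_tendsto_compose[OF isCont_rpoly tendsto_vertical, of p x] by (simp add: rpoly_of_real)

text \<open>Where g_N^2 differs from 1 the squares of G_00 and G_11 have real limits, nonpositive if
  g_N^2 < 1 and nonnegative otherwise, so \<open>tendsto_Im_of_square\<close> applies;
  \<open>\<sigma>\<close> merges the two cases.\<close>

lemma green_boundary_values:
  assumes N: "N \<ge> 1" and rr: "real_rooted ((gN_poly a N)\<^sup>2 - 1)"
    and x: "(poly (gN_poly a N) x)\<^sup>2 \<noteq> 1"
  defines "z \<equiv> \<lambda>n. Complex x (inverse (real (Suc n)))"
    and "\<sigma> \<equiv> (if (poly (gN_poly a N) x)\<^sup>2 < 1 then 1 / sqrt (1 - (poly (gN_poly a N) x)\<^sup>2) else 0)"
  shows "(\<lambda>n. Im (green a N 0 0 (z n))) \<longlonglongrightarrow> - (\<bar>poly (Pstar a N N) x\<bar> / 2 * \<sigma>)"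
    and "(\<lambda>n. Im (green a N 0 1 (z n))) \<longlonglongrightarrow> - ((x - a) * (\<bar>poly (Pstar a N N) x\<bar> / 2 * \<sigma>))"
    and "(\<lambda>n. Im (green a N 1 1 (z n))) \<longlonglongrightarrow> - (\<bar>poly (Ppoly a N (N - 1)) x\<bar> * \<sigma>)"
proof -
  let ?p = "(gN_poly a N)\<^sup>2 - 1"
  have Im: "Im (z n) > 0" for n by (simp add: z_def)
  then have Im0: "Im (z n) \<noteq> 0" for n by (metis less_irrefl)
  have neg: "Im (green a N 0 0 (z n)) \<le> 0" "Im (green a N 1 1 (z n)) \<le> 0" for n
    using green_real_rooted[OF N rr Im0[of n]] Im[of n] by metis+
  have px: "poly ?p x = (poly (gN_poly a N) x)\<^sup>2 - 1" by simp
  have px0: "poly ?p x \<noteq> 0" using x by simp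
  have lim: "(\<lambda>n. (rpoly q (z n))\<^sup>2 / rpoly ?p (z n)) \<longlonglongrightarrow> of_real ((poly q x)\<^sup>2 / poly ?p x)" for q
  proof -
    have "(\<lambda>n. (rpoly q (z n))\<^sup>2 / rpoly ?p (z n)) \<longlonglongrightarrow> (of_real (poly q x))\<^sup>2 / of_real (poly ?p x)"
      unfolding z_def by (intro tendsto_intros rpoly_tendsto_vertical) (use px0 in \<open>simp only: of_real_eq_0_iff not_False_eq_True\<close>)
    then show ?thesis by simp
  qed
  have val: "sqrt ((\<bar>(poly q x)\<^sup>2 / poly ?p x\<bar> - (poly q x)\<^sup>2 / poly ?p x) / 2) = \<bar>poly q x\<bar> * \<sigma>" for q
  proof (cases "(poly (gN_poly a N) x)\<^sup>2 < 1")
    case True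
    have "(poly q x)\<^sup>2 / poly ?p x = - ((poly q x)\<^sup>2 / (1 - (poly (gN_poly a N) x)\<^sup>2))"
      unfolding px by (metis minus_diff_eq minus_divide_right)
    moreover have "(poly q x)\<^sup>2 / (1 - (poly (gN_poly a N) x)\<^sup>2) \<ge> 0" using True by simp
    moreover have "(\<bar>t\<bar> - t) / 2 = r" if "t = - r" "0 \<le> r" for t r :: real using that by simp
    ultimately have eq: "(\<bar>(poly q x)\<^sup>2 / poly ?p x\<bar> - (poly q x)\<^sup>2 / poly ?p x) / 2 =
        (poly q x)\<^sup>2 / (1 - (poly (gN_poly a N) x)\<^sup>2)"
      by blast
    show ?thesis unfolding eq using True by (simp add: \<sigma>_def real_sqrt_divide)
  next
    case False
    then have "(poly q x)\<^sup>2 / poly ?p x \<ge> 0" unfolding px by simp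
    then show ?thesis using False by (simp add: \<sigma>_def)
  qed
  have g00: "(green a N 0 0 (z n))\<^sup>2 = (rpoly (odd_poly a N N) (z n))\<^sup>2 / rpoly ?p (z n)" for n
    using green_squares(1)[OF N rr Im0[of n]] by (simp add: odd_sol_def)
  have "(\<lambda>n. Im (green a N 0 0 (z n))) \<longlonglongrightarrow> - (\<bar>poly (odd_poly a N N) x\<bar> * \<sigma>)"
    unfolding val[symmetric] by (rule tendsto_Im_of_square) (use lim g00 neg in simp_all)
  then show 0: "(\<lambda>n. Im (green a N 0 0 (z n))) \<longlonglongrightarrow> - (\<bar>poly (Pstar a N N) x\<bar> / 2 * \<sigma>)"
    by (simp add: odd_poly_def abs_mult)
  have g11: "(green a N 1 1 (z n))\<^sup>2 = (rpoly (Ppoly a N (N - 1)) (z n))\<^sup>2 / rpoly ?p (z n)" for n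
    by (rule green_squares(2)[OF N rr Im0[of n]])
  show "(\<lambda>n. Im (green a N 1 1 (z n))) \<longlonglongrightarrow> - (\<bar>poly (Ppoly a N (N - 1)) x\<bar> * \<sigma>)"
    unfolding val[symmetric] by (rule tendsto_Im_of_square) (use lim g11 neg in simp_all)
  \<comment> \<open>The limit for G_01 goes through G_00. No limit of Re G_00 is at hand, but it is
    bounded by the square root of |G_00^2|, which converges, and it is multiplied by the
    height.\<close>
  have "(\<lambda>n. inverse (real (Suc n)) * Re (green a N 0 0 (z n))) \<longlonglongrightarrow> 0"
  proof (rule Lim_null_comparison)
    show "(\<lambda>n. inverse (real (Suc n)) * sqrt (cmod ((green a N 0 0 (z n))\<^sup>2))) \<longlonglongrightarrow> 0"
    proof -
      have "(\<lambda>n. inverse (real (Suc n)) * sqrt (cmod ((green a N 0 0 (z n))\<^sup>2))) \<longlonglongrightarrow>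
          0 * sqrt (cmod (of_real ((poly (odd_poly a N N) x)\<^sup>2 / poly ?p x)))"
        unfolding g00 by (intro tendsto_mult LIMSEQ_inverse_real_of_nat tendsto_real_sqrt tendsto_norm lim)
      then show ?thesis by simp
    qed
    show "\<forall>\<^sub>F n in sequentially. norm (inverse (real (Suc n)) * Re (green a N 0 0 (z n)))
        \<le> inverse (real (Suc n)) * sqrt (cmod ((green a N 0 0 (z n))\<^sup>2))"
      using abs_Re_le_cmod by (intro always_eventually allI) (auto simp: abs_mult norm_power intro!: mult_left_mono)
  qed
  then have "(\<lambda>n. (x - a) * Im (green a N 0 0 (z n)) + inverse (real (Suc n)) * Re (green a N 0 0 (z n)))
      \<longlonglongrightarrow> (x - a) * - (\<bar>poly (Pstar a N N) x\<bar> / 2 * \<sigma>) + 0"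
    by (intro tendsto_add tendsto_mult tendsto_const 0)
  moreover have "Im (green a N 0 1 (z n)) =
      (x - a) * Im (green a N 0 0 (z n)) + inverse (real (Suc n)) * Re (green a N 0 0 (z n))" for n
  proof -
    have "green a N 0 1 (z n) = (z n - of_real a) * green a N 0 0 (z n) - 1"
      using green_real_rooted[OF N rr Im0[of n]] by metis
    then show ?thesis by (simp add: z_def)
  qed
  ultimately show "(\<lambda>n. Im (green a N 0 1 (z n))) \<longlonglongrightarrow> - ((x - a) * (\<bar>poly (Pstar a N N) x\<bar> / 2 * \<sigma>))"
    by simp
qed

text \<open>All heights lie in (0, 1], hence all points in one compact rectangle.\<close>

lemma rpoly_bounded_rectangle:
  obtains B where "B \<ge> 0"
    "\<And>x n. x \<in> {c..d} \<Longrightarrow> cmod (rpoly p (Complex x (inverse (real (Suc n))))) \<le> B"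
proof -
  let ?R = "cbox (Complex c 0) (Complex d 1)"
  have "compact (rpoly p ` ?R)"
    by (intro compact_continuous_image continuous_on_rpoly compact_cbox)
  then obtain B where B: "\<And>y. y \<in> rpoly p ` ?R \<Longrightarrow> cmod y \<le> B"
    using bounded_iff compact_imp_bounded by metis
  \<comment> \<open>For \<open>c > d\<close> the rectangle is empty and \<open>B\<close> may be
    negative; hence the maximum with 0.\<close>
  have "cmod (rpoly p (Complex x (inverse (real (Suc n))))) \<le> max 0 B" if "x \<in> {c..d}" for x n
  proof -
    have "inverse (real (Suc n)) \<le> 1" by (simp add: inverse_le_1_iff)
    then have "Complex x (inverse (real (Suc n))) \<in> ?R"
      using that by (simp add: in_cbox_complex_iff)
    then show ?thesis using B by (meson imageI max.coboundedI2)
  qed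
  then show ?thesis using that[of "max 0 B"] by auto
qed

text \<open>The entries are bounded through |m| and 1 / |m|, each with one simple-rooted polynomial
  in the denominator. Points with g_N^2 = 1 are left out because there 1 / sqrt 0 = 0 would make the
  majorant too small.\<close>

lemma green_dominated:
  assumes N: "N \<ge> 1" and rr: "real_rooted ((gN_poly a N)\<^sup>2 - 1)"
  shows "\<exists>w. integrable lborel (\<lambda>x. indicator {c..d} x * w x) \<and>
    (\<forall>x n. x \<in> {c..d} \<longrightarrow> (poly (gN_poly a N) x)\<^sup>2 \<noteq> 1 \<longrightarrow>
       cmod (green a N 0 0 (Complex x (inverse (real (Suc n))))) \<le> w x \<and>
       cmod (green a N 0 1 (Complex x (inverse (real (Suc n))))) \<le> w x \<and>
       cmod (green a N 1 1 (Complex x (inverse (real (Suc n))))) \<le> w x)"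
proof -
  let ?z = "\<lambda>x n. Complex x (inverse (real (Suc n)))"
  let ?D = "disc_poly a N" and ?s = "odd_poly a N N"
  have rD: "real_rooted ?D" and rs: "real_rooted ?s"
    using real_rooted_mult rr unfolding gN_poly_square[OF N] by blast+
  obtain BD where BD: "BD \<ge> 0" "\<And>x n. x \<in> {c..d} \<Longrightarrow> cmod (rpoly ?D (?z x n)) \<le> BD"
    using rpoly_bounded_rectangle by blast
  obtain Bs where Bs: "Bs \<ge> 0" "\<And>x n. x \<in> {c..d} \<Longrightarrow> cmod (rpoly ?s (?z x n)) \<le> Bs"
    using rpoly_bounded_rectangle by blast
  obtain Bl where Bl: "Bl \<ge> 0" "\<And>x n. x \<in> {c..d} \<Longrightarrow> cmod (rpoly [:- a, 1:] (?z x n)) \<le> Bl"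
    using rpoly_bounded_rectangle by blast
  define u where "u = (\<lambda>x. sqrt Bs * (1 / sqrt \<bar>poly ?D x\<bar>))"
  define v where "v = (\<lambda>x. sqrt BD * (1 / sqrt \<bar>poly ?s x\<bar>))"
  \<comment> \<open>Dominates the three bounds \<open>u\<close>, \<open>Bl * u + 1\<close> and
    \<open>Bl\<^sup>2 * u + v\<close> of the entries 00, 01 and 11.\<close>
  define w where "w = (\<lambda>x. (1 + Bl + Bl\<^sup>2) * u x + v x + 1)"
  have int: "integrable lborel (\<lambda>x. indicator {c..d} x * (1 / sqrt \<bar>poly ?D x\<bar>))"
    "integrable lborel (\<lambda>x. indicator {c..d} x * (1 / sqrt \<bar>poly ?s x\<bar>))"
    using integrable_inverse_sqrt_real_rooted[OF rD simple_root_disc[OF N]]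
      integrable_inverse_sqrt_real_rooted[OF rs simple_root_odd[OF N]] by blast+
  have "integrable lborel (\<lambda>x. (1 + Bl + Bl\<^sup>2) * sqrt Bs * (indicator {c..d} x * (1 / sqrt \<bar>poly ?D x\<bar>))
      + sqrt BD * (indicator {c..d} x * (1 / sqrt \<bar>poly ?s x\<bar>)) + indicator {c..d} x)"
    by (intro Bochner_Integration.integrable_add integrable_mult_right int integrable_real_indicator)
      (auto simp: emeasure_lborel_Icc_eq)
  also have "(\<lambda>x. (1 + Bl + Bl\<^sup>2) * sqrt Bs * (indicator {c..d} x * (1 / sqrt \<bar>poly ?D x\<bar>))
      + sqrt BD * (indicator {c..d} x * (1 / sqrt \<bar>poly ?s x\<bar>)) + indicator {c..d} x) =
      (\<lambda>x. indicator {c..d} x * w x)"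
    by (auto simp: w_def u_def v_def indicator_def mult.assoc)
  finally have "integrable lborel (\<lambda>x. indicator {c..d} x * w x)" .
  moreover have "cmod (green a N 0 0 (?z x n)) \<le> w x \<and> cmod (green a N 0 1 (?z x n)) \<le> w x \<and>
      cmod (green a N 1 1 (?z x n)) \<le> w x"
    if x: "x \<in> {c..d}" "(poly (gN_poly a N) x)\<^sup>2 \<noteq> 1" for x n
  proof -
    let ?y = "?z x n"
    have Im: "Im ?y \<noteq> 0" by simp
    obtain m where m: "m\<^sup>2 = rpoly ?D ?y / odd_sol a N ?y (int N)"
      and g: "green a N 0 0 ?y = - 1 / m"
        "green a N 0 1 ?y = (?y - of_real a) * green a N 0 0 ?y - 1"
        "green a N 1 1 ?y = (?y - of_real a)\<^sup>2 * green a N 0 0 ?y + m"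
      using green_real_rooted[OF N rr Im] by metis
    have s: "odd_sol a N ?y (int N) = rpoly ?s ?y" by (simp add: odd_sol_def)
    have "poly ((gN_poly a N)\<^sup>2 - 1) x \<noteq> 0" using x(2) by simp
    then have nz: "poly ?D x \<noteq> 0" "poly ?s x \<noteq> 0"
      unfolding gN_poly_square[OF N] by auto
    have "cmod m = sqrt (cmod (rpoly ?D ?y) / cmod (rpoly ?s ?y))"
      by (metis m s norm_divide norm_ge_zero norm_power real_sqrt_unique)
    also have "\<dots> \<le> sqrt (BD / \<bar>poly ?s x\<bar>)"
      using nz BD x(1) real_rooted_norm_ge[OF rs, of x "inverse (real (Suc n))"]
      by (intro real_sqrt_le_mono frac_le) auto
    also have "\<dots> = v x" by (simp add: v_def real_sqrt_divide)
    finally have mv: "cmod m \<le> v x" .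
    have "(green a N 0 0 ?y)\<^sup>2 = rpoly ?s ?y / rpoly ?D ?y"
      unfolding g(1) power_divide m s by simp
    then have "cmod (green a N 0 0 ?y) = sqrt (cmod (rpoly ?s ?y) / cmod (rpoly ?D ?y))"
      by (metis norm_divide norm_ge_zero norm_power real_sqrt_unique)
    also have "\<dots> \<le> sqrt (Bs / \<bar>poly ?D x\<bar>)"
      using nz Bs x(1) real_rooted_norm_ge[OF rD, of x "inverse (real (Suc n))"]
      by (intro real_sqrt_le_mono frac_le) auto
    also have "\<dots> = u x" by (simp add: u_def real_sqrt_divide)
    finally have gu: "cmod (green a N 0 0 ?y) \<le> u x" .
    have l: "cmod (?y - of_real a) \<le> Bl" using Bl(2)[OF x(1), of n] by simp
    have u0: "u x \<ge> 0" and v0: "v x \<ge> 0" using Bs BD by (auto simp: u_def v_def)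
    have w: "w x = u x + Bl * u x + Bl\<^sup>2 * u x + v x + 1" by (simp add: w_def algebra_simps)
    have nn: "Bl * u x \<ge> 0" "Bl\<^sup>2 * u x \<ge> 0" using Bl(1) u0 by simp_all
    have 1: "cmod ((?y - of_real a) * green a N 0 0 ?y) \<le> Bl * u x"
      unfolding norm_mult by (intro mult_mono l gu Bl) simp
    have 2: "cmod ((?y - of_real a)\<^sup>2 * green a N 0 0 ?y) \<le> Bl\<^sup>2 * u x"
      unfolding norm_mult norm_power by (intro mult_mono power_mono l gu) simp_all
    have "cmod (green a N 0 1 ?y) \<le> Bl * u x + 1"
      unfolding g(2) using norm_triangle_ineq4[of "(?y - of_real a) * green a N 0 0 ?y" 1] 1 by simp
    moreover have "cmod (green a N 1 1 ?y) \<le> Bl\<^sup>2 * u x + v x"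
      unfolding g(3) using norm_triangle_ineq[of "(?y - of_real a)\<^sup>2 * green a N 0 0 ?y" m] 2 mv by linarith
    ultimately show ?thesis unfolding w using gu nn u0 v0 by linarith
  qed
  ultimately show ?thesis by blast
qed

section \<open>Densities of the spectral measure\<close>

theorem theorem7p3:
  fixes N :: nat and a :: real
    and \<xi> :: "nat \<Rightarrow> real"
    and \<mu> :: "int \<Rightarrow> int \<Rightarrow> real set \<Rightarrow> real"
  defines "U \<equiv> (\<Union>k\<in>{1..N}. {\<xi> (2 * k - 1)<..<\<xi> (2 * k)})"
    and "g \<equiv> poly (gN_poly a N)"
  assumes "N \<ge> 1" and "a > 0"
    and roots: "proots ((gN_poly a N)\<^sup>2 - 1) = image_mset \<xi> (mset_set {1..2 * N})"
    and "\<And>k. k \<in> {1..N} \<Longrightarrow> \<xi> (2 * k - 1) < \<xi> (2 * k)"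
    and "\<And>k. k \<in> {1..<N} \<Longrightarrow> \<xi> (2 * k) \<le> \<xi> (2 * k + 1)"
    and spectral: "is_spectral_measure (jacobi_op a N) \<mu>"
  shows "absolutely_continuous_with_density (\<mu> 0 0)
           (\<lambda>x. if x \<in> U then \<bar>poly (Pstar a N N) x\<bar> / (2 * pi * sqrt (1 - (g x)\<^sup>2)) else 0) \<and>
         absolutely_continuous_with_density (\<mu> 0 1)
           (\<lambda>x. if x \<in> U then (x - a) * \<bar>poly (Pstar a N N) x\<bar> / (2 * pi * sqrt (1 - (g x)\<^sup>2)) else 0) \<and>
         absolutely_continuous_with_density (\<mu> 1 1)
           (\<lambda>x. if x \<in> U then \<bar>poly (Ppoly a N (N - 1)) x\<bar> / (pi * sqrt (1 - (g x)\<^sup>2)) else 0)"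
proof -
  note N = \<open>N \<ge> 1\<close>
  have rr: "real_rooted ((gN_poly a N)\<^sup>2 - 1)"
    by (rule gN_square_real_rooted(1)[OF N roots])
  have G: "has_real_measure_integral (\<mu> i j) (\<lambda>x. 1 / (z - complex_of_real x)) (green a N i j z)"
    if "i \<in> {0, 1}" "j \<in> {0, 1}" "z \<notin> \<real>" for i j z
    using spectral that unfolding is_spectral_measure_def green_def by blast
  have [measurable]: "U \<in> sets borel" unfolding U_def by (intro sets.finite_UN) auto
  have [measurable]: "g \<in> borel_measurable borel" unfolding g_def by measurable
  have "bounded U" unfolding U_def by (intro bounded_UN) auto
  then obtain B where B: "\<And>x. x \<in> U \<Longrightarrow> \<bar>x\<bar> \<le> B" by (auto simp: bounded_iff)
  define b where "b = \<bar>B\<bar> + 1"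
  have supp: "- b < b" "\<And>x. x \<notin> {- b..b} \<Longrightarrow> x \<notin> U" using B by (force simp: b_def)+
  \<comment> \<open>\<open>gN_square_bands\<close> gives weak inequalities on \<open>U\<close> and
    on its complement; away from g^2 = 1 they are strict and decide membership in
    \<open>U\<close>.\<close>
  have band: "x \<in> U \<longleftrightarrow> (g x)\<^sup>2 < 1" if "(g x)\<^sup>2 \<noteq> 1" for x
    using gN_square_bands[OF N roots assms(6,7), of x] that unfolding U_def g_def by fastforce
  \<comment> \<open>The exceptional points, band edges and closed gaps, are the finitely many roots
    of g_N^2 - 1.\<close>
  have AE: "AE x in lborel. (g x)\<^sup>2 \<noteq> 1"
  proof -
    have "finite {x. poly ((gN_poly a N)\<^sup>2 - 1) x = 0}"
      using rr by (intro poly_roots_finite) (simp add: real_rooted_def)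
    from AE_not_in[OF finite_imp_null_set_lborel[OF this]] show ?thesis
      by eventually_elim (simp add: g_def)
  qed
  have dom: "\<exists>w. integrable lborel (\<lambda>x. indicator {c..d} x * w x) \<and>
      (AE x in lborel. x \<in> {c..d} \<longrightarrow> (\<forall>n. cmod (green a N i j (Complex x (inverse (real (Suc n))))) \<le> w x))"
    if "(i, j) \<in> {(0, 0), (0, 1), (1, 1)}" for i j :: int and c d
  proof -
    obtain w where w: "integrable lborel (\<lambda>x. indicator {c..d} x * w x)"
      and b: "\<forall>x n. x \<in> {c..d} \<longrightarrow> (poly (gN_poly a N) x)\<^sup>2 \<noteq> 1 \<longrightarrow>
         cmod (green a N 0 0 (Complex x (inverse (real (Suc n))))) \<le> w x \<and>
         cmod (green a N 0 1 (Complex x (inverse (real (Suc n))))) \<le> w x \<and>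
         cmod (green a N 1 1 (Complex x (inverse (real (Suc n))))) \<le> w x"
      using green_dominated[OF N rr, where c = c and d = d] by blast
    have "AE x in lborel. x \<in> {c..d} \<longrightarrow> (\<forall>n. cmod (green a N i j (Complex x (inverse (real (Suc n))))) \<le> w x)"
      using AE by eventually_elim (use b that in \<open>auto simp: g_def\<close>)
    with w show ?thesis by blast
  qed
  have lim: "(\<lambda>n. - Im (green a N 0 0 (Complex x (inverse (real (Suc n))))) / pi) \<longlonglongrightarrow>
        (if x \<in> U then \<bar>poly (Pstar a N N) x\<bar> / (2 * pi * sqrt (1 - (g x)\<^sup>2)) else 0)"
      "(\<lambda>n. - Im (green a N 0 1 (Complex x (inverse (real (Suc n))))) / pi) \<longlonglongrightarrow>
        (if x \<in> U then (x - a) * \<bar>poly (Pstar a N N) x\<bar> / (2 * pi * sqrt (1 - (g x)\<^sup>2)) else 0)"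
      "(\<lambda>n. - Im (green a N 1 1 (Complex x (inverse (real (Suc n))))) / pi) \<longlonglongrightarrow>
        (if x \<in> U then \<bar>poly (Ppoly a N (N - 1)) x\<bar> / (pi * sqrt (1 - (g x)\<^sup>2)) else 0)"
    if x: "(g x)\<^sup>2 \<noteq> 1" for x
  proof -
    have lim': "(\<lambda>n. - X n / pi) \<longlonglongrightarrow> l" if "X \<longlonglongrightarrow> - L" "l = L / pi" for X :: "nat \<Rightarrow> real" and L l
      using tendsto_divide[OF tendsto_minus[OF that(1)] tendsto_const[of pi]] that(2) by simp
    note bv = green_boundary_values[OF N rr x[unfolded g_def], folded g_def]
    show "(\<lambda>n. - Im (green a N 0 0 (Complex x (inverse (real (Suc n))))) / pi) \<longlonglongrightarrow>
        (if x \<in> U then \<bar>poly (Pstar a N N) x\<bar> / (2 * pi * sqrt (1 - (g x)\<^sup>2)) else 0)"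
      by (rule lim'[OF bv(1)]) (simp add: band[OF x])
    show "(\<lambda>n. - Im (green a N 0 1 (Complex x (inverse (real (Suc n))))) / pi) \<longlonglongrightarrow>
        (if x \<in> U then (x - a) * \<bar>poly (Pstar a N N) x\<bar> / (2 * pi * sqrt (1 - (g x)\<^sup>2)) else 0)"
      by (rule lim'[OF bv(2)]) (simp add: band[OF x])
    show "(\<lambda>n. - Im (green a N 1 1 (Complex x (inverse (real (Suc n))))) / pi) \<longlonglongrightarrow>
        (if x \<in> U then \<bar>poly (Ppoly a N (N - 1)) x\<bar> / (pi * sqrt (1 - (g x)\<^sup>2)) else 0)"
      by (rule lim'[OF bv(3)]) (simp add: band[OF x])
  qed
  show ?thesis
  proof (intro conjI)
    show "absolutely_continuous_with_density (\<mu> 0 0)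
           (\<lambda>x. if x \<in> U then \<bar>poly (Pstar a N N) x\<bar> / (2 * pi * sqrt (1 - (g x)\<^sup>2)) else 0)"
    proof (rule stieltjes_density[OF G _ supp(1) _ _ dom])
      show "AE x in lborel. (\<lambda>n. - Im (green a N 0 0 (Complex x (inverse (real (Suc n))))) / pi) \<longlonglongrightarrow>
        (if x \<in> U then \<bar>poly (Pstar a N N) x\<bar> / (2 * pi * sqrt (1 - (g x)\<^sup>2)) else 0)"
        using AE by eventually_elim (rule lim(1))
    qed (use supp(2) in auto)
    show "absolutely_continuous_with_density (\<mu> 0 1)
           (\<lambda>x. if x \<in> U then (x - a) * \<bar>poly (Pstar a N N) x\<bar> / (2 * pi * sqrt (1 - (g x)\<^sup>2)) else 0)"
    proof (rule stieltjes_density[OF G _ supp(1) _ _ dom])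
      show "AE x in lborel. (\<lambda>n. - Im (green a N 0 1 (Complex x (inverse (real (Suc n))))) / pi) \<longlonglongrightarrow>
        (if x \<in> U then (x - a) * \<bar>poly (Pstar a N N) x\<bar> / (2 * pi * sqrt (1 - (g x)\<^sup>2)) else 0)"
        using AE by eventually_elim (rule lim(2))
    qed (use supp(2) in auto)
    show "absolutely_continuous_with_density (\<mu> 1 1)
           (\<lambda>x. if x \<in> U then \<bar>poly (Ppoly a N (N - 1)) x\<bar> / (pi * sqrt (1 - (g x)\<^sup>2)) else 0)"
    proof (rule stieltjes_density[OF G _ supp(1) _ _ dom])
      show "AE x in lborel. (\<lambda>n. - Im (green a N 1 1 (Complex x (inverse (real (Suc n))))) / pi) \<longlonglongrightarrow>
        (if x \<in> U then \<bar>poly (Ppoly a N (N - 1)) x\<bar> / (pi * sqrt (1 - (g x)\<^sup>2)) else 0)"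
        using AE by eventually_elim (rule lim(3))
    qed (use supp(2) in auto)
  qed
qed

end
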